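(* For every $s\ge 4$ and $t\ge 1$ there is a constant $c=c(s,t)$ such that for all $n\ge 2$, $R^{1,t}_3(s,n)\le 2^{\log^c n}$.
   Context: Let $P=\{p_1,\dots,p_N\}$ be an ordered set of points in $\mathbb{R}^d$ and let $\binom{P}{k}$ denote the set of $k$-tuples $(p_{i_1},\dots,p_{i_k})$ with $i_1<\dots<i_k$. A relation $E\subset\binom{P}{k}$ is semi-algebraic of complexity at most $t$ if there are polynomials $f_1,\dots,f_t\in\mathbb{R}[x_1,\dots,x_{dk}]$ of degree at most $t$ and a Boolean function $\Phi$ such that, with $E^*=\{x\in\mathbb{R}^{dk}:\Phi(f_1(x)\ge 0,\dots,f_t(x)\ge 0)=1\}$, we have $(p_{i_1},\dots,p_{i_k})\in E$ iff $(p_{i_1},\dots,p_{i_k})\in E^*$ for all $i_1<\dots<i_k$. $R^{d,t}_k(s,n)$ is the minimum $N$ such that for every sequence $P$ of $N$ points in $\mathbb{R}^d$ and every $k$-ary semi-algebraic relation $E\subset\binom{P}{k}$ of complexity at most $t$, either $P$ has $s$ members all of whose $k$-tuples lie in $E$, or $P$ has $n$ members none of whose $k$-tuples lie in $E$. *)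

theory Defs
  imports "HOL-Library.Poly_Mapping" "HOL-Library.Extended_Real"
begin

(* Real multivariate polynomials as finitely supported coefficient functions on
   monomials; a monomial is a finitely supported exponent function, and the
   variable with index i (counted from 0) is the i-th coordinate. *)
type_synonym rpoly = "(nat \<Rightarrow>\<^sub>0 nat) \<Rightarrow>\<^sub>0 real"

definition monom_degree :: "(nat \<Rightarrow>\<^sub>0 nat) \<Rightarrow> nat" where
  "monom_degree m = (\<Sum>i\<in>Poly_Mapping.keys m. Poly_Mapping.lookup m i)"

(* Membership in R[x_0, ..., x_(n-1)]. *)
definition poly_in_vars :: "nat \<Rightarrow> rpoly \<Rightarrow> bool" where
  "poly_in_vars n f \<longleftrightarrow> (\<forall>m\<in>Poly_Mapping.keys f. Poly_Mapping.keys m \<subseteq> {..<n})"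

(* Bound on the total degree; the zero polynomial satisfies every bound. *)
definition total_degree_le :: "nat \<Rightarrow> rpoly \<Rightarrow> bool" where
  "total_degree_le t f \<longleftrightarrow> (\<forall>m\<in>Poly_Mapping.keys f. monom_degree m \<le> t)"

definition rpoly_eval :: "rpoly \<Rightarrow> real list \<Rightarrow> real" where
  "rpoly_eval f x =
     (\<Sum>m\<in>Poly_Mapping.keys f. Poly_Mapping.lookup f m *
        (\<Prod>i\<in>Poly_Mapping.keys m. (x ! i) ^ Poly_Mapping.lookup m i))"

definition euclidean_points :: "nat \<Rightarrow> real list set" where
  "euclidean_points d = {x. length x = d}"

definition increasing_tuples :: "nat \<Rightarrow> nat set \<Rightarrow> nat list set" where
  "increasing_tuples k I = {js. length js = k \<and> sorted_wrt (<) js \<and> set js \<subseteq> I}"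

(* For I = {..<length P} this is the set "P choose k" of k-tuples
   (p_i1, ..., p_ik) with i1 < ... < ik; for smaller I it is the set of those
   k-tuples formed by the members of P with index in I. *)
definition point_tuples :: "nat \<Rightarrow> 'a list \<Rightarrow> nat set \<Rightarrow> 'a list set" where
  "point_tuples k P I = (\<lambda>js. map (\<lambda>j. P ! j) js) ` increasing_tuples k I"

definition semialg_set ::
    "nat \<Rightarrow> rpoly list \<Rightarrow> (bool list \<Rightarrow> bool) \<Rightarrow> real list set" where
  "semialg_set n fs \<Phi> =
     {x \<in> euclidean_points n. \<Phi> (map (\<lambda>f. rpoly_eval f x \<ge> 0) fs)}"

(* "concat" identifies a k-tuple of points of R^d with a point of R^(d*k). *)
definition semialg_relation ::
    "nat \<Rightarrow> nat \<Rightarrow> nat \<Rightarrow> real list list \<Rightarrow> real list list set \<Rightarrow> bool" where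
  "semialg_relation d k t P E \<longleftrightarrow>
     E \<subseteq> point_tuples k P {..<length P} \<and>
     (\<exists>fs \<Phi>. length fs = t \<and>
        (\<forall>f\<in>set fs. poly_in_vars (d * k) f \<and> total_degree_le t f) \<and>
        (\<forall>q\<in>point_tuples k P {..<length P}.
            q \<in> E \<longleftrightarrow> concat q \<in> semialg_set (d * k) fs \<Phi>))"

(* Members of the sequence P are counted by index; P may have repeated points. *)
definition semialg_ramsey_property ::
    "nat \<Rightarrow> nat \<Rightarrow> nat \<Rightarrow> nat \<Rightarrow> nat \<Rightarrow> nat \<Rightarrow> bool" where
  "semialg_ramsey_property d t k s n N \<longleftrightarrow>
     (\<forall>P E. length P = N \<and> set P \<subseteq> euclidean_points d \<and> semialg_relation d k t P E \<longrightarrow>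
        (\<exists>S\<subseteq>{..<N}. card S = s \<and> point_tuples k P S \<subseteq> E) \<or>
        (\<exists>S\<subseteq>{..<N}. card S = n \<and> point_tuples k P S \<inter> E = {}))"

(* The infimum in enat is the minimum of a nonempty set and infinity for the
   empty set, so a finite upper bound includes the existence of the minimum. *)
definition semialg_ramsey :: "nat \<Rightarrow> nat \<Rightarrow> nat \<Rightarrow> nat \<Rightarrow> nat \<Rightarrow> enat" where
  "semialg_ramsey d t k s n = (INF N\<in>{N. semialg_ramsey_property d t k s n N}. enat N)"

end

theory Submission
  imports Defs "HOL-Library.Sublist" "HOL-Library.FuncSet" "HOL-Computational_Algebra.Polynomial"
begin

text \<open>
  Passing to a strictly monotone subsequence, the colour of a triple becomes a function of a
  3-element set of reals which, two points being fixed, changes only boundedly often as the third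
  one moves along the line. Cut the sorted points into $2M$ blocks, each block into $2M$ subblocks, and
  so on, $D$ times, and choose in every node of the binary tree of depth $D$ one of the first $M$ and
  one of the last $M$ blocks at random. A given pair of leaves outside a subtree splits
  this subtree with probability at most $C/M$, because the candidate blocks for its root are disjoint.
  Hence for $M = 2^{O(D)}$ some choice of leaves makes the colour of every triple depend only on its two
  branching nodes, that is, on a comparable pair of nodes of the tree.

  For colourings of comparable pairs there is a polynomial Ramsey bound: depth $D = (2q)^r$ yields
  a red chain of $r$ nodes or a blue embedded binary tree of depth $q$. Adding one leaf per node, a
  red chain gives $r + 1$ points all of whose triples are red, and a blue tree gives $2^q$ points all of
  whose triples are blue. With $r = s - 1$ and $2^q \<ge> n$ this needs only
  $(2M)^D = 2^{O(D^2)}$ points, where $D$ is polylogarithmic in $n$.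
\<close>

section \<open>A chain or antichain lemma\<close>

text \<open>Induction on \<open>a\<close>. Elements without an earlier \<open>R\<close>-predecessor
  are pairwise \<open>S\<close>-related. If there are at most \<open>b\<close> of them, they are
  deleted, and a chain found in the rest is extended by an earlier \<open>R\<close>-predecessor of
  its least element.\<close>

lemma chain_or_antichain:
  fixes R S :: "'a::linorder \<Rightarrow> 'a \<Rightarrow> bool"
  assumes "transp R" "finite I" "card I > a * b"
    and "\<And>i j. i \<in> I \<Longrightarrow> j \<in> I \<Longrightarrow> i < j \<Longrightarrow> R i j \<or> S i j"
  shows "(\<exists>J\<subseteq>I. card J = Suc a \<and> (\<forall>i\<in>J. \<forall>j\<in>J. i < j \<longrightarrow> R i j)) \<or>
         (\<exists>J\<subseteq>I. card J = Suc b \<and> (\<forall>i\<in>J. \<forall>j\<in>J. i < j \<longrightarrow> S i j))"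
  using assms(2-)
proof (induction a arbitrary: I)
  case 0
  then obtain x where "x \<in> I" by (metis card.empty ex_in_conv less_nat_zero_code)
  then have "{x} \<subseteq> I \<and> card {x} = Suc 0 \<and> (\<forall>i\<in>{x}. \<forall>j\<in>{x}. i < j \<longrightarrow> R i j)" by simp
  then show ?case by blast
next
  case (Suc a)
  define I0 where "I0 = {i \<in> I. \<forall>j\<in>I. j < i \<longrightarrow> \<not> R j i}"
  have fin0: "finite I0" "I0 \<subseteq> I" using Suc.prems(1) by (auto simp: I0_def)
  show ?case
  proof (cases "card I0 \<ge> Suc b")
    case True
    then obtain J where J: "J \<subseteq> I0" "card J = Suc b" by (meson obtain_subset_with_card_n)
    then have "\<forall>i\<in>J. \<forall>j\<in>J. i < j \<longrightarrow> S i j"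
      using Suc.prems(3) unfolding I0_def by blast
    then show ?thesis using J fin0 by blast
  next
    case False
    have "card (I - I0) = card I - card I0" using fin0 by (simp add: card_Diff_subset)
    then have c: "card (I - I0) > a * b" using False Suc.prems(2) by (auto simp: algebra_simps)
    have "(\<exists>J\<subseteq>I - I0. card J = Suc a \<and> (\<forall>i\<in>J. \<forall>j\<in>J. i < j \<longrightarrow> R i j)) \<or>
         (\<exists>J\<subseteq>I - I0. card J = Suc b \<and> (\<forall>i\<in>J. \<forall>j\<in>J. i < j \<longrightarrow> S i j))"
      using Suc.prems c by (intro Suc.IH) auto
    then show ?thesis
    proof
      assume "\<exists>J\<subseteq>I - I0. card J = Suc a \<and> (\<forall>i\<in>J. \<forall>j\<in>J. i < j \<longrightarrow> R i j)"
      then obtain J where J: "J \<subseteq> I - I0" "card J = Suc a" "\<And>i j. i \<in> J \<Longrightarrow> j \<in> J \<Longrightarrow> i < j \<Longrightarrow> R i j"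
        by blast
      have finJ: "finite J" using J(2) by (metis card.infinite nat.distinct(1))
      define x where "x = Min J"
      have "J \<noteq> {}" using J(2) by auto
      then have x: "x \<in> J" "\<And>y. y \<in> J \<Longrightarrow> x \<le> y" using finJ by (auto simp: x_def)
      then obtain j where j: "j \<in> I" "j < x" "R j x" using J(1) by (auto simp: I0_def)
      have jy: "R j y" if "y \<in> J" for y
        using that x J(3)[of x y] j assms(1) by (metis le_neq_trans transpD)
      have notin: "j \<notin> J" using j x by fastforce
      have "\<forall>i\<in>insert j J. \<forall>k\<in>insert j J. i < k \<longrightarrow> R i k"
        using J(3) jy x(2) j(2) by fastforce
      moreover have "insert j J \<subseteq> I" "card (insert j J) = Suc (Suc a)"
        using J j finJ notin by auto
      ultimately show ?thesis by blast
    qed blast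
  qed
qed

subsection \<open>Semi-algebraic colourings along a coordinate line\<close>

lemma rpoly_eval_coordinate:
  assumes "poly_in_vars (length xs) f" "total_degree_le t f" "i < length xs"
  shows "\<exists>p. degree p \<le> t \<and> (\<forall>x. rpoly_eval f (xs[i := x]) = poly p x)"
proof -
  define c where "c m = Poly_Mapping.lookup f m *
    (\<Prod>j\<in>Poly_Mapping.keys m - {i}. (xs ! j) ^ Poly_Mapping.lookup m j)" for m
  define p where "p = (\<Sum>m\<in>Poly_Mapping.keys f. monom (c m) (Poly_Mapping.lookup m i))"
  have "Poly_Mapping.lookup m i \<le> t" if m: "m \<in> Poly_Mapping.keys f" for m
  proof (cases "i \<in> Poly_Mapping.keys m")
    case True
    then have "Poly_Mapping.lookup m i \<le> monom_degree m"
      unfolding monom_degree_def by (intro member_le_sum) auto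
    then show ?thesis using m assms(2) by (force simp: total_degree_le_def)
  qed (simp add: in_keys_iff)
  then have "degree p \<le> t"
    unfolding p_def by (intro degree_sum_le) (auto intro: order_trans[OF degree_monom_le])
  moreover have "rpoly_eval f (xs[i := x]) = poly p x" for x
  proof -
    have "(\<Prod>j\<in>Poly_Mapping.keys m. (xs[i := x] ! j) ^ Poly_Mapping.lookup m j) =
      x ^ Poly_Mapping.lookup m i * (\<Prod>j\<in>Poly_Mapping.keys m - {i}. (xs ! j) ^ Poly_Mapping.lookup m j)"
      (is "?l = _ * ?r") for m
    proof -
      have r: "(\<Prod>j\<in>Poly_Mapping.keys m - {i}. (xs[i := x] ! j) ^ Poly_Mapping.lookup m j) = ?r"
        by (intro prod.cong) auto
      show ?thesis
      proof (cases "i \<in> Poly_Mapping.keys m")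
        case True
        then show ?thesis
          using r assms(3) by (subst prod.remove[of _ i]) auto
      next
        case False
        then show ?thesis using r by (simp add: in_keys_iff)
      qed
    qed
    then show ?thesis
      by (simp add: rpoly_eval_def p_def c_def poly_sum poly_monom mult_ac)
  qed
  ultimately show ?thesis by blast
qed

text \<open>By the intermediate value theorem the sign condition changes only at roots; the zero
  polynomial needs no break.\<close>

lemma poly_sign_breaks:
  fixes p :: "real poly"
  shows "\<exists>F. finite F \<and> card F \<le> degree p \<and>
    (\<forall>x x'. x \<le> x' \<longrightarrow> {x..x'} \<inter> F = {} \<longrightarrow> (poly p x \<ge> 0) = (poly p x' \<ge> 0))"
proof (cases "p = 0")
  case False
  let ?F = "{x. poly p x = 0}"
  have "(poly p x \<ge> 0) = (poly p x' \<ge> 0)" if "x \<le> x'" "{x..x'} \<inter> ?F = {}" for x x'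
  proof (rule ccontr)
    assume a: "(poly p x \<ge> 0) \<noteq> (poly p x' \<ge> 0)"
    have "x < x'" using a that(1) by (cases "x = x'") auto
    moreover have "poly p x \<noteq> 0" "poly p x' \<noteq> 0" using that by auto
    ultimately have "\<exists>y. x < y \<and> y < x' \<and> poly p y = 0"
      using a poly_IVT_pos[of x x' p] poly_IVT_neg[of x x' p] by (meson linorder_not_le not_less_iff_gr_or_eq)
    then obtain y where "x < y" "y < x'" "poly p y = 0" by blast
    then have "y \<in> {x..x'} \<inter> ?F" by simp
    then show False using that(2) by blast
  qed
  then show ?thesis using False poly_roots_finite card_poly_roots_bound by blast
qed (auto intro!: exI[of _ "{}"])

text \<open>\<open>F\<close> may depend on the line, but the bound on its size is uniform. Since
  closed intervals have to avoid \<open>F\<close>, the value at a break itself is free: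
  \<open>p \<ge> 0\<close> may hold just at a root.\<close>

definition few_coordinate_breaks :: "nat \<Rightarrow> nat \<Rightarrow> (real list \<Rightarrow> bool) \<Rightarrow> bool" where
  "few_coordinate_breaks n C Q \<longleftrightarrow> (\<forall>xs i. length xs = n \<longrightarrow> i < n \<longrightarrow>
     (\<exists>F. finite F \<and> card F \<le> C \<and>
       (\<forall>x x'. x \<le> x' \<longrightarrow> {x..x'} \<inter> F = {} \<longrightarrow> Q (xs[i := x]) = Q (xs[i := x']))))"

lemma few_coordinate_breaks_semialg:
  assumes "\<And>f. f \<in> set fs \<Longrightarrow> poly_in_vars n f \<and> total_degree_le t f"
  shows "few_coordinate_breaks n (length fs * t) (\<lambda>x. \<Phi> (map (\<lambda>f. rpoly_eval f x \<ge> 0) fs))"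
  unfolding few_coordinate_breaks_def
proof (intro allI impI)
  fix xs :: "real list" and i
  assume xs: "length xs = n" "i < n"
  have "\<exists>F. finite F \<and> card F \<le> t \<and> (\<forall>x x'. x \<le> x' \<longrightarrow> {x..x'} \<inter> F = {} \<longrightarrow>
      (rpoly_eval f (xs[i := x]) \<ge> 0) = (rpoly_eval f (xs[i := x']) \<ge> 0))" if "f \<in> set fs" for f
    using rpoly_eval_coordinate[of xs f t i] poly_sign_breaks assms[OF that] xs by (metis order_trans)
  then obtain F where F: "\<And>f. f \<in> set fs \<Longrightarrow> finite (F f)" "\<And>f. f \<in> set fs \<Longrightarrow> card (F f) \<le> t"
    "\<And>f x x'. f \<in> set fs \<Longrightarrow> x \<le> x' \<Longrightarrow> {x..x'} \<inter> F f = {} \<Longrightarrow>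
      (rpoly_eval f (xs[i := x]) \<ge> 0) = (rpoly_eval f (xs[i := x']) \<ge> 0)"
    by metis
  have "card (\<Union>f\<in>set fs. F f) \<le> (\<Sum>f\<in>set fs. card (F f))" by (intro card_UN_le) auto
  also have "\<dots> \<le> card (set fs) * t" using F(2) sum_bounded_above[of "set fs" "\<lambda>f. card (F f)" t] by simp
  also have "\<dots> \<le> length fs * t" by (simp add: card_length)
  finally have "card (\<Union>f\<in>set fs. F f) \<le> length fs * t" .
  moreover have "finite (\<Union>f\<in>set fs. F f)" using F(1) by auto
  moreover have "map (\<lambda>f. rpoly_eval f (xs[i := x]) \<ge> 0) fs = map (\<lambda>f. rpoly_eval f (xs[i := x']) \<ge> 0) fs"
    if "x \<le> x'" "{x..x'} \<inter> (\<Union>f\<in>set fs. F f) = {}" for x x'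
    using that by (intro map_cong refl F(3)) auto
  ultimately show "\<exists>F. finite F \<and> card F \<le> length fs * t \<and> (\<forall>x x'. x \<le> x' \<longrightarrow> {x..x'} \<inter> F = {} \<longrightarrow>
      \<Phi> (map (\<lambda>f. rpoly_eval f (xs[i := x]) \<ge> 0) fs) = \<Phi> (map (\<lambda>f. rpoly_eval f (xs[i := x']) \<ge> 0) fs))"
    by metis
qed

text \<open>Meant for decreasing sequences; reversal sends coordinate \<open>i\<close> to coordinate
  \<open>n - i - 1\<close>.\<close>

lemma few_coordinate_breaks_rev:
  assumes "few_coordinate_breaks n C Q"
  shows "few_coordinate_breaks n C (\<lambda>x. Q (rev x))"
  unfolding few_coordinate_breaks_def
proof (intro allI impI)
  fix xs :: "real list" and i
  assume xs: "length xs = n" "i < n"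
  then have "\<exists>F. finite F \<and> card F \<le> C \<and> (\<forall>x x'. x \<le> x' \<longrightarrow> {x..x'} \<inter> F = {} \<longrightarrow>
     Q ((rev xs)[n - i - 1 := x]) = Q ((rev xs)[n - i - 1 := x']))"
    using assms unfolding few_coordinate_breaks_def by simp
  then show "\<exists>F. finite F \<and> card F \<le> C \<and> (\<forall>x x'. x \<le> x' \<longrightarrow> {x..x'} \<inter> F = {} \<longrightarrow>
     Q (rev (xs[i := x])) = Q (rev (xs[i := x'])))"
    using xs by (simp add: rev_update)
qed

definition few_breaks :: "nat \<Rightarrow> (real set \<Rightarrow> bool) \<Rightarrow> bool" where
  "few_breaks C \<chi> \<longleftrightarrow> (\<forall>y z. y \<noteq> z \<longrightarrow> (\<exists>F. finite F \<and> card F \<le> C \<and>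
     (\<forall>x x'. x \<le> x' \<longrightarrow> {x..x'} \<inter> F = {} \<longrightarrow> \<chi> {x, y, z} = \<chi> {x', y, z})))"

text \<open>According to its place, the moving point fills slot 0, 1 or 2 of the sorted triple. Each
  slot contributes at most \<open>C\<close> breaks, and the slot changes at the 2 fixed
  points.\<close>

lemma few_breaks_sorted_list_of_set:
  assumes "few_coordinate_breaks 3 C Q"
  shows "few_breaks (3 * C + 2) (\<lambda>T. Q (sorted_list_of_set T))"
proof -
  have main: "\<exists>F. finite F \<and> card F \<le> 3 * C + 2 \<and> (\<forall>x x'. x \<le> x' \<longrightarrow> {x..x'} \<inter> F = {} \<longrightarrow>
      Q (sorted_list_of_set {x, y, z}) = Q (sorted_list_of_set {x', y, z}))" if yz: "y < z" for y z
  proof -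
    have s: "sorted_list_of_set {x, y, z} =
      (if x < y then [x, y, z] else if x < z then [y, x, z] else [y, z, x])" if "x \<noteq> y" "x \<noteq> z" for x
      using yz that by (auto simp: sorted_list_of_set_insert_remove)
    obtain F0 where F0: "finite F0" "card F0 \<le> C"
      "\<And>x x'. x \<le> x' \<Longrightarrow> {x..x'} \<inter> F0 = {} \<Longrightarrow> Q [x, y, z] = Q [x', y, z]"
      using assms[unfolded few_coordinate_breaks_def, rule_format, of "[0, y, z]" 0] by auto
    obtain F1 where F1: "finite F1" "card F1 \<le> C"
      "\<And>x x'. x \<le> x' \<Longrightarrow> {x..x'} \<inter> F1 = {} \<Longrightarrow> Q [y, x, z] = Q [y, x', z]"
      using assms[unfolded few_coordinate_breaks_def, rule_format, of "[y, 0, z]" 1] by auto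
    obtain F2 where F2: "finite F2" "card F2 \<le> C"
      "\<And>x x'. x \<le> x' \<Longrightarrow> {x..x'} \<inter> F2 = {} \<Longrightarrow> Q [y, z, x] = Q [y, z, x']"
      using assms[unfolded few_coordinate_breaks_def, rule_format, of "[y, z, 0]" 2] by auto
    let ?F = "F0 \<union> (F1 \<union> (F2 \<union> {y, z}))"
    have "card ?F \<le> 3 * C + 2"
    proof -
      have "card {y, z} = 2" using yz by simp
      then show ?thesis
        using card_Un_le[of F0 "F1 \<union> (F2 \<union> {y, z})"] card_Un_le[of F1 "F2 \<union> {y, z}"]
          card_Un_le[of F2 "{y, z}"] F0(2) F1(2) F2(2) by linarith
    qed
    moreover have "Q (sorted_list_of_set {x, y, z}) = Q (sorted_list_of_set {x', y, z})"
      if x: "x \<le> x'" "{x..x'} \<inter> ?F = {}" for x x'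
    proof -
      have "y \<notin> {x..x'}" "z \<notin> {x..x'}" using x(2) by auto
      then have "x' < y \<or> y < x \<and> x' < z \<or> z < x" by auto
      moreover have "Q [x, y, z] = Q [x', y, z]" using F0(3)[OF x(1)] x(2) by blast
      moreover have "Q [y, x, z] = Q [y, x', z]" using F1(3)[OF x(1)] x(2) by blast
      moreover have "Q [y, z, x] = Q [y, z, x']" using F2(3)[OF x(1)] x(2) by blast
      ultimately show ?thesis using x(1) yz by (auto simp: s)
    qed
    moreover have "finite ?F" using F0(1) F1(1) F2(1) by simp
    ultimately show ?thesis by (intro exI[of _ ?F] conjI allI impI)
  qed
  show ?thesis
    unfolding few_breaks_def
  proof (intro allI impI)
    fix y z :: real assume "y \<noteq> z"
    then consider "y < z" | "z < y" by linarith
    then show "\<exists>F. finite F \<and> card F \<le> 3 * C + 2 \<and> (\<forall>x x'. x \<le> x' \<longrightarrow> {x..x'} \<inter> F = {} \<longrightarrow>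
      Q (sorted_list_of_set {x, y, z}) = Q (sorted_list_of_set {x', y, z}))"
    proof cases
      case 1
      then show ?thesis by (rule main)
    next
      case 2
      then show ?thesis using main[of z y] by (simp only: insert_commute[of z y "{}"])
    qed
  qed
qed

subsection \<open>Ramsey theory for comparable pairs of tree nodes\<close>

text \<open>
  Nodes of the infinite binary tree are Boolean lists; the root is the empty list and the children of
  \<open>u\<close> are \<open>b # u\<close>, so that descendants of \<open>u\<close> are the lists with suffix \<open>u\<close>.
\<close>

primrec blue_tree :: "(bool list \<Rightarrow> bool list \<Rightarrow> bool) \<Rightarrow> nat \<Rightarrow> bool list set \<Rightarrow> bool" where
  "blue_tree R 0 A \<longleftrightarrow> True"
| "blue_tree R (Suc q) A \<longleftrightarrow> (\<exists>v\<in>A. \<forall>b. blue_tree R q {w \<in> A. suffix (b # v) w \<and> \<not> R v w})"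

text \<open>As in \<open>blue_tree\<close>, the shrinking set passes the colour condition at
  \<open>v\<close> on to all later nodes, so that all comparable pairs are covered, not only
  consecutive ones. The chain leaves \<open>v\<close> on one side \<open>b\<close>; the other side
  is kept for an extra leaf.\<close>

primrec red_chain :: "(bool list \<Rightarrow> bool list \<Rightarrow> bool) \<Rightarrow> nat \<Rightarrow> bool list set \<Rightarrow> bool" where
  "red_chain R 0 A \<longleftrightarrow> True"
| "red_chain R (Suc r) A \<longleftrightarrow> (\<exists>v\<in>A. \<exists>b. red_chain R r {w \<in> A. suffix (b # v) w \<and> R v w})"

text \<open>Without red pairs the colour condition is void, which leaves embedded complete binary
  trees.\<close>

abbreviation full_tree :: "nat \<Rightarrow> bool list set \<Rightarrow> bool" where
  "full_tree \<equiv> blue_tree (\<lambda>_ _. False)"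

lemma blue_tree_mono: "blue_tree R q A \<Longrightarrow> A \<subseteq> B \<Longrightarrow> blue_tree R q B"
proof (induction q arbitrary: A B)
  case (Suc q)
  then obtain v where v: "v \<in> A" "\<And>b. blue_tree R q {w \<in> A. suffix (b # v) w \<and> \<not> R v w}" by auto
  have "blue_tree R q {w \<in> B. suffix (b # v) w \<and> \<not> R v w}" for b
    using v(2)[of b] Suc.prems(2) by (rule_tac Suc.IH) auto
  then show ?case using v(1) Suc.prems(2) by auto
qed simp

lemma full_tree_le: "full_tree n A \<Longrightarrow> m \<le> n \<Longrightarrow> full_tree m A"
proof (induction n arbitrary: m A)
  case (Suc n)
  then show ?case by (cases m) auto
qed simp

text \<open>The recursion spends one level of the tree on either \<open>a\<close> or \<open>b\<close>, depending on the set containing the root.\<close>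

lemma full_tree_Un: "full_tree (a + b) (X \<union> Y) \<Longrightarrow> full_tree a X \<or> full_tree b Y"
proof (induction "a + b" arbitrary: a b X Y)
  case (Suc n)
  let ?below = "\<lambda>c v A. {w \<in> A. suffix (c # v) w}"
  from Suc.prems Suc.hyps(2) have "full_tree (Suc n) (X \<union> Y)" by simp
  then obtain v where v: "v \<in> X \<union> Y" "\<And>c. full_tree n (?below c v (X \<union> Y))" by auto
  have split: "?below c v (X \<union> Y) = ?below c v X \<union> ?below c v Y" for c by auto
  have up: "full_tree b (?below c v Y) \<Longrightarrow> full_tree b Y" "full_tree a (?below c v X) \<Longrightarrow> full_tree a X" for c
    by (erule blue_tree_mono, auto)+
  show ?case
  proof (cases "a = 0 \<or> b = 0")
    case False
    then obtain a' b' where ab: "a = Suc a'" "b = Suc b'" by (metis not0_implies_Suc)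
    have 1: "full_tree a' (?below c v X) \<or> full_tree b (?below c v Y)" for c
      using v(2)[of c] ab Suc.hyps(2) unfolding split by (intro Suc.hyps(1)) auto
    have 2: "full_tree a (?below c v X) \<or> full_tree b' (?below c v Y)" for c
      using v(2)[of c] ab Suc.hyps(2) unfolding split by (intro Suc.hyps(1)) auto
    show ?thesis
    proof (cases "v \<in> X")
      case True
      then have "full_tree (Suc a') X" if "\<And>c. full_tree a' (?below c v X)" using that by auto
      then show ?thesis using 1 up(1) ab(1) by blast
    next
      case False
      then have "full_tree (Suc b') Y" if "\<And>c. full_tree b' (?below c v Y)" using that v(1) by auto
      then show ?thesis using 2 up(2) ab(2) by blast
    qed
  qed auto
qed simp

text \<open>Below either child of the root, the descendants are divided into those red and those
  blue to the root. The red ones contain no full tree of depth \<open>d\<close>, so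
  \<open>full_tree_Un\<close> leaves the remaining depth to the blue ones. Each level of the blue
  tree costs 1 level for its root and \<open>d\<close> for the red part.\<close>

lemma blue_tree_greedy:
  assumes "\<And>v b. v \<in> A \<Longrightarrow> \<not> full_tree d {w \<in> A. suffix (b # v) w \<and> R v w}"
    and "full_tree (q * (d + 1)) A"
  shows "blue_tree R q A"
  using assms
proof (induction q arbitrary: A)
  case (Suc q)
  have "Suc q * (d + 1) = Suc (d + q * (d + 1))" by simp
  then have "full_tree (Suc (d + q * (d + 1))) A" using Suc.prems(2) by (simp only:)
  then obtain v where v: "v \<in> A" "\<And>b. full_tree (d + q * (d + 1)) {w \<in> A. suffix (b # v) w}"
    by auto
  have "blue_tree R q {w \<in> A. suffix (b # v) w \<and> \<not> R v w}" (is "blue_tree R q ?B") for b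
  proof (rule Suc.IH)
    have "{w \<in> A. suffix (b # v) w} = {w \<in> A. suffix (b # v) w \<and> R v w} \<union> ?B" by auto
    then have "full_tree (d + q * (d + 1)) ({w \<in> A. suffix (b # v) w \<and> R v w} \<union> ?B)"
      using v(2)[of b] by (simp only:)
    then show "full_tree (q * (d + 1)) ?B" using Suc.prems(1)[OF v(1)] full_tree_Un by blast
    show "\<not> full_tree d {w \<in> ?B. suffix (c # u) w \<and> R u w}" if "u \<in> ?B" for u c
    proof
      assume "full_tree d {w \<in> ?B. suffix (c # u) w \<and> R u w}"
      then have "full_tree d {w \<in> A. suffix (c # u) w \<and> R u w}" by (rule blue_tree_mono) blast
      then show False using Suc.prems(1)[of u c] that by blast
    qed
  qed
  then show ?case using v(1) by auto
qed simp

text \<open>Induction on \<open>r\<close>. A node with a full tree of depth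
  \<open>(2 * q) ^ r\<close> among its red descendants on one side can start the chain, unless these
  descendants already contain a blue tree. If there is no such node, the greedy construction
  applies.\<close>

lemma red_chain_or_blue_tree:
  assumes "full_tree ((2 * q) ^ r) A" "q > 0"
  shows "red_chain R r A \<or> blue_tree R q A"
  using assms(1)
proof (induction r arbitrary: A)
  case (Suc r)
  let ?d = "(2 * q) ^ r"
  show ?case
  proof (cases "\<exists>v\<in>A. \<exists>b. full_tree ?d {w \<in> A. suffix (b # v) w \<and> R v w}")
    case True
    then obtain v b where v: "v \<in> A" "full_tree ?d {w \<in> A. suffix (b # v) w \<and> R v w}" by blast
    from Suc.IH[OF v(2)] show ?thesis
    proof
      assume "blue_tree R q {w \<in> A. suffix (b # v) w \<and> R v w}"
      then show ?thesis using blue_tree_mono[of R q _ A] by blast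
    qed (use v(1) in auto)
  next
    case False
    \<comment> \<open>The greedy construction needs depth \<open>q * (?d + 1)\<close>; this is at
      most \<open>2 * q * ?d\<close>, whence the base \<open>2 * q\<close>.\<close>
    have "?d \<ge> 1" using assms(2) by simp
    then have "q * (?d + 1) \<le> q * (2 * ?d)" by (intro mult_left_mono) auto
    then have "q * (?d + 1) \<le> (2 * q) ^ Suc r" by (simp add: mult_ac)
    then show ?thesis using False blue_tree_greedy[of A ?d R q] full_tree_le[OF Suc.prems] by blast
  qed
qed simp

lemma full_tree_bounded_length:
  assumes "length u + n \<le> D" "{w. suffix u w \<and> length w < D} \<subseteq> A"
  shows "full_tree n A"
  using assms
proof (induction n arbitrary: u A)
  case (Suc n)
  have "full_tree n {w \<in> A. suffix (b # u) w \<and> \<not> False}" for b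
  proof (rule Suc.IH)
    show "length (b # u) + n \<le> D" using Suc.prems(1) by simp
    show "{w. suffix (b # u) w \<and> length w < D} \<subseteq> {w \<in> A. suffix (b # u) w \<and> \<not> False}"
      using Suc.prems(2) by (auto dest: suffix_ConsD)
  qed
  moreover have "u \<in> A" using Suc.prems by auto
  ultimately show ?case by auto
qed simp

section \<open>From chains and trees of nodes to homogeneous sets of leaves\<close>

definition leaves :: "nat \<Rightarrow> bool list set" where
  "leaves D = {x. length x = D}"

text \<open>The lowest common ancestor; quantifying over \<open>b\<close> makes the relation
  symmetric in \<open>x\<close> and \<open>y\<close>.\<close>

definition meets_at :: "bool list \<Rightarrow> bool list \<Rightarrow> bool list \<Rightarrow> bool" where
  "meets_at w x y \<longleftrightarrow> (\<exists>b. suffix (b # w) x \<and> suffix ((\<not> b) # w) y)"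

text \<open>The set \<open>A\<close> of admissible branching nodes is the induction invariant: a
  node added higher up controls the mixed triples through the nodes at which the pairs below it
  branch.\<close>

definition homogeneous_leaves :: "(bool list set \<Rightarrow> bool) \<Rightarrow> bool \<Rightarrow> bool list set \<Rightarrow> bool list set \<Rightarrow> bool" where
  "homogeneous_leaves \<chi> c A S \<longleftrightarrow> finite S \<and> (\<forall>x\<in>S. \<forall>y\<in>S. x \<noteq> y \<longrightarrow> (\<exists>w\<in>A. meets_at w x y)) \<and>
     (\<forall>x\<in>S. \<forall>y\<in>S. \<forall>z\<in>S. x \<noteq> y \<longrightarrow> x \<noteq> z \<longrightarrow> y \<noteq> z \<longrightarrow> \<chi> {x, y, z} = c)"

text \<open>Three distinct leaves can always be ordered so that two of them meet at some
  \<open>w\<close> below one child of \<open>v\<close> and the third lies below the other child. So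
  the assumption reduces the colours of all triples to a colouring \<open>R\<close> of comparable
  pairs.\<close>

locale tree_colouring =
  fixes D :: nat and \<chi> :: "bool list set \<Rightarrow> bool" and R :: "bool list \<Rightarrow> bool list \<Rightarrow> bool"
  assumes colour: "\<lbrakk>x \<in> leaves D; y \<in> leaves D; z \<in> leaves D; suffix (b # v) w; meets_at w x y;
    suffix ((\<not> b) # v) z\<rbrakk> \<Longrightarrow> \<chi> {x, y, z} = R v w"
begin

text \<open>Three leaves on the same side are covered by \<open>hom\<close>. If two are on side
  \<open>b\<close> and one on the other side, the two meet at some \<open>w\<close> with
  \<open>R v w = c\<close>, and this is the colour of the triple.\<close>

lemma homogeneous_join:
  assumes "v \<in> A"
    and hom: "\<And>b. homogeneous_leaves \<chi> c {w \<in> A. suffix (b # v) w \<and> R v w = c} (S b)"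
    and sub: "\<And>b. S b \<subseteq> {x \<in> leaves D. suffix (b # v) x}"
  shows "homogeneous_leaves \<chi> c A (S False \<union> S True)"
    and "card (S False \<union> S True) = card (S False) + card (S True)"
proof -
  have disj: "S False \<inter> S True = {}"
  proof -
    have "\<not> (suffix (False # v) x \<and> suffix (True # v) x)" for x by (auto simp: suffix_def)
    then show ?thesis using sub by blast
  qed
  have fin: "finite (S b)" for b using hom by (auto simp: homogeneous_leaves_def)
  then show "card (S False \<union> S True) = card (S False) + card (S True)"
    using disj by (simp add: card_Un_disjoint)
  have meet: "\<exists>w\<in>A. meets_at w x y" if "x \<in> S b" "y \<in> S b'" "x \<noteq> y" for x y b b'
  proof (cases "b = b'")
    case True
    then show ?thesis using hom[of b] that unfolding homogeneous_leaves_def by blast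
  next
    case False
    then have "b' = (\<not> b)" by auto
    then have "meets_at v x y"
      using sub[of b] sub[of b'] that unfolding meets_at_def by (intro exI[of _ b]) blast
    then show ?thesis using assms(1) by blast
  qed
  have same: "\<chi> {x, y, z} = c" if "x \<in> S b" "y \<in> S b" "z \<in> S b" "x \<noteq> y" "x \<noteq> z" "y \<noteq> z" for x y z b
    using hom[of b] that unfolding homogeneous_leaves_def by blast
  have two: "\<chi> {x, y, z} = c" if "x \<in> S b" "y \<in> S b" "z \<in> S (\<not> b)" "x \<noteq> y" for x y z b
  proof -
    have "\<exists>w\<in>{w \<in> A. suffix (b # v) w \<and> R v w = c}. meets_at w x y"
      using hom[of b] that(1,2,4) unfolding homogeneous_leaves_def by (elim conjE) blast
    then obtain w where w: "suffix (b # v) w" "R v w = c" "meets_at w x y" by blast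
    have "x \<in> leaves D" "y \<in> leaves D" "z \<in> leaves D" "suffix ((\<not> b) # v) z"
      using sub[of b] sub[of "\<not> b"] that(1-3) by blast+
    then show ?thesis using colour[OF _ _ _ w(1,3)] w(2) by blast
  qed
  have perm: "{x, y, z} = {x, z, y}" "{x, y, z} = {y, z, x}" for x y z :: "bool list" by auto
  have "\<chi> {x, y, z} = c" if "x \<in> S b1" "y \<in> S b2" "z \<in> S b3" "x \<noteq> y" "x \<noteq> z" "y \<noteq> z" for x y z b1 b2 b3
  proof -
    consider "b1 = b2" "b2 = b3" | "b1 = b2" "b3 = (\<not> b1)" | "b1 = b3" "b2 = (\<not> b1)" | "b2 = b3" "b1 = (\<not> b2)"
      by auto
    then show ?thesis
    proof cases
      case 1
      then show ?thesis using same that by blast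
    next
      case 2
      then show ?thesis using two[of x b1 y z] that by blast
    next
      case 3
      then show ?thesis using two[of x b1 z y] that perm(1)[of x y z] by simp
    next
      case 4
      then show ?thesis using two[of y b2 z x] that perm(2)[of x y z] by simp
    qed
  qed
  then show "homogeneous_leaves \<chi> c A (S False \<union> S True)"
    using fin meet unfolding homogeneous_leaves_def by blast
qed

lemma homogeneous_leaf:
  assumes "length u \<le> D"
  obtains x where "x \<in> leaves D" "suffix u x" "homogeneous_leaves \<chi> c A {x}"
proof
  show "replicate (D - length u) False @ u \<in> leaves D" using assms by (simp add: leaves_def)
qed (simp_all add: homogeneous_leaves_def suffix_def)

text \<open>Each level joins sets of leaves from the two sides of its root, which doubles the size.
  The bounding node \<open>u\<close> varies so that the induction can descend to a child.\<close>

lemma blue_tree_leaves: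
  assumes "blue_tree R q A" "\<And>w. w \<in> A \<Longrightarrow> suffix u w \<and> length w < D" "length u \<le> D"
  shows "\<exists>S\<subseteq>{x \<in> leaves D. suffix u x}. card S = 2 ^ q \<and> homogeneous_leaves \<chi> False A S"
  using assms
proof (induction q arbitrary: A u)
  case 0
  obtain x where "x \<in> leaves D" "suffix u x" "homogeneous_leaves \<chi> False A {x}"
    using homogeneous_leaf 0(3) by blast
  then show ?case by (intro exI[of _ "{x}"]) auto
next
  case (Suc q)
  then obtain v where v: "v \<in> A" "\<And>b. blue_tree R q {w \<in> A. suffix (b # v) w \<and> \<not> R v w}" by auto
  let ?P = "\<lambda>b S. S \<subseteq> {x \<in> leaves D. suffix (b # v) x} \<and> card S = 2 ^ q \<and>
      homogeneous_leaves \<chi> False {w \<in> A. suffix (b # v) w \<and> \<not> R v w} S"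
  have "\<exists>S. ?P b S" for b
    using v Suc.prems(2) by (intro Suc.IH) (auto simp: Suc_le_eq)
  then have "\<exists>S. \<forall>b. ?P b (S b)" by (intro choice allI)
  then obtain S where S: "\<And>b. S b \<subseteq> {x \<in> leaves D. suffix (b # v) x}" "\<And>b. card (S b) = 2 ^ q"
    "\<And>b. homogeneous_leaves \<chi> False {w \<in> A. suffix (b # v) w \<and> \<not> R v w} (S b)"
    by blast
  have "suffix u x" if "suffix (b # v) x" for b x
    using suffix_order.trans[of u v x] suffix_ConsD[OF that] v(1) Suc.prems(2) by blast
  then have "S False \<union> S True \<subseteq> {x \<in> leaves D. suffix u x}" using S(1) by blast
  then show ?case
    using homogeneous_join[of v A False S] v(1) S by (intro exI[of _ "S False \<union> S True"]) auto
qed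

text \<open>Every node of the chain contributes one leaf on the side that the chain does not take,
  and the end of the chain contributes one more, hence \<open>Suc r\<close>.\<close>

lemma red_chain_leaves:
  assumes "red_chain R r A" "\<And>w. w \<in> A \<Longrightarrow> suffix u w \<and> length w < D" "length u \<le> D"
  shows "\<exists>S\<subseteq>{x \<in> leaves D. suffix u x}. card S = Suc r \<and> homogeneous_leaves \<chi> True A S"
  using assms
proof (induction r arbitrary: A u)
  case 0
  obtain x where "x \<in> leaves D" "suffix u x" "homogeneous_leaves \<chi> True A {x}"
    using homogeneous_leaf 0(3) by blast
  then show ?case by (intro exI[of _ "{x}"]) auto
next
  case (Suc r)
  then obtain v b where v: "v \<in> A" "red_chain R r {w \<in> A. suffix (b # v) w \<and> R v w}" by auto
  have len: "length (b' # v) \<le> D" for b' using v Suc.prems(2) by (auto simp: Suc_le_eq)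
  have "\<exists>S\<subseteq>{x \<in> leaves D. suffix (b # v) x}. card S = Suc r \<and>
      homogeneous_leaves \<chi> True {w \<in> A. suffix (b # v) w \<and> R v w} S"
    using v Suc.prems(2) len by (intro Suc.IH) auto
  then obtain S where S: "S \<subseteq> {x \<in> leaves D. suffix (b # v) x}" "card S = Suc r"
    "homogeneous_leaves \<chi> True {w \<in> A. suffix (b # v) w \<and> R v w} S" by blast
  obtain x where x: "x \<in> leaves D" "suffix ((\<not> b) # v) x"
    "homogeneous_leaves \<chi> True {w \<in> A. suffix ((\<not> b) # v) w \<and> R v w} {x}"
    using homogeneous_leaf len by blast
  \<comment> \<open>A single leaf is homogeneous over any set of nodes, so it can represent the side
    off the chain whatever the values of \<open>R\<close> there.\<close>
  define S' where "S' b' = (if b' = b then S else {x})" for b'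
  have "S' b' \<subseteq> {x \<in> leaves D. suffix (b' # v) x} \<and>
      homogeneous_leaves \<chi> True {w \<in> A. suffix (b' # v) w \<and> R v w = True} (S' b')" for b'
    using S x by (cases b; cases b') (simp_all add: S'_def)
  note join = homogeneous_join[of v A True S', OF v(1) conjunct2[OF this] conjunct1[OF this]]
  have un: "S' False \<union> S' True = S \<union> {x}" by (cases b) (auto simp: S'_def)
  have "card (S \<union> {x}) = Suc (Suc r)" using join(2) S(2) unfolding un by (cases b) (simp_all add: S'_def)
  moreover have "suffix u y" if "suffix (c # v) y" for c y
    using suffix_order.trans[of u v y] suffix_ConsD[OF that] v(1) Suc.prems(2) by blast
  then have "S \<union> {x} \<subseteq> {x \<in> leaves D. suffix u x}" using S(1) x by blast
  ultimately show ?case using join(1) unfolding un by blast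
qed

lemma tree_ramsey:
  assumes "D \<ge> (2 * q) ^ r" "q > 0"
  shows "(\<exists>S\<subseteq>leaves D. card S = Suc r \<and> homogeneous_leaves \<chi> True UNIV S) \<or>
    (\<exists>S\<subseteq>leaves D. card S = 2 ^ q \<and> homogeneous_leaves \<chi> False UNIV S)"
proof -
  let ?A = "{w. length w < D}"
  have mono: "homogeneous_leaves \<chi> c UNIV S" if "homogeneous_leaves \<chi> c ?A S" for c S
    using that unfolding homogeneous_leaves_def by blast
  have "full_tree ((2 * q) ^ r) ?A"
    using assms(1) by (intro full_tree_bounded_length[of "[]" _ D]) auto
  then consider "red_chain R r ?A" | "blue_tree R q ?A"
    using red_chain_or_blue_tree[of q r ?A R] assms(2) by blast
  then show ?thesis
  proof cases
    case 1
    obtain S where "S \<subseteq> {x \<in> leaves D. suffix [] x}" "card S = Suc r" "homogeneous_leaves \<chi> True ?A S"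
      using red_chain_leaves[OF 1, of "[]"] by auto
    then show ?thesis using mono by (intro disjI1 exI[of _ S]) auto
  next
    case 2
    obtain S where "S \<subseteq> {x \<in> leaves D. suffix [] x}" "card S = 2 ^ q" "homogeneous_leaves \<chi> False ?A S"
      using blue_tree_leaves[OF 2, of "[]"] by auto
    then show ?thesis using mono by (intro disjI2 exI[of _ S]) auto
  qed
qed

end

subsection \<open>Random embeddings of binary trees\<close>

lemma suffix_Cons_unique:
  assumes "suffix (b # v) x" "suffix (c # v) x"
  shows "b = c"
proof -
  have "suffix (b # v) (c # v)" "suffix (c # v) (b # v)"
    using suffix_length_suffix[OF assms] suffix_length_suffix[OF assms(2,1)] by simp_all
  then have "b # v = c # v" by (rule suffix_order.antisym)
  then show ?thesis by simp
qed

text \<open>The index set of the random choices. The root is left out: its block is the whole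
  sequence.\<close>

definition nodes :: "nat \<Rightarrow> bool list set" where
  "nodes D = {u. u \<noteq> [] \<and> length u \<le> D}"

text \<open>
  The index of the block of a node \<open>u\<close> among the $(2M)^{|u|}$ blocks of its level; \<open>r\<close> chooses
  the block within the left or right half of the parent block.
\<close>

primrec position :: "nat \<Rightarrow> (bool list \<Rightarrow> nat) \<Rightarrow> bool list \<Rightarrow> nat" where
  "position M r [] = 0"
| "position M r (b # u) = position M r u * (2 * M) + ((if b then M else 0) + r (b # u))"

lemma finite_nodes: "finite (nodes D)" and card_nodes_le: "card (nodes D) \<le> 2 ^ (D + 1)"
proof -
  have sub: "nodes D \<subseteq> {u. set u \<subseteq> UNIV \<and> length u \<le> D}" by (auto simp: nodes_def)
  have fin: "finite {u :: bool list. set u \<subseteq> UNIV \<and> length u \<le> D}"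
    by (intro finite_lists_length_le) simp
  show "finite (nodes D)" using finite_subset[OF sub fin] .
  have "card (nodes D) \<le> (\<Sum>i\<le>D. 2 ^ i)"
    using card_mono[OF fin sub] card_lists_length_le[of "UNIV :: bool set" D] by simp
  also have "\<dots> < 2 ^ (D + 1)" by (induction D) auto
  finally show "card (nodes D) \<le> 2 ^ (D + 1)" by simp
qed

lemma finite_leaves: "finite (leaves D)" and card_leaves: "card (leaves D) = 2 ^ D"
  using finite_lists_length_eq[of "UNIV :: bool set" D] card_lists_length_eq[of "UNIV :: bool set" D]
  by (simp_all add: leaves_def)

text \<open>\<open>position\<close> reads \<open>r\<close> only along the path to the root, so a new
  choice at \<open>u\<close> moves nothing outside the subtree of \<open>u\<close>.\<close>

lemma position_fun_upd: "\<not> suffix u v \<Longrightarrow> position M (r(u := a)) v = position M r v"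
proof (induction v)
  case (Cons b v)
  then have "b # v \<noteq> u" "\<not> suffix u v" by (auto simp: suffix_Cons)
  then show ?case using Cons.IH by simp
qed simp

lemma digit_less:
  fixes M :: nat
  assumes "r \<in> nodes D \<rightarrow>\<^sub>E {..<M}" "length (b # u) \<le> D"
  shows "(if b then M else 0) + r (b # u) < 2 * M"
proof -
  have "b # u \<in> nodes D" using assms(2) by (simp add: nodes_def)
  then have "r (b # u) < M" using assms(1) by auto
  then show ?thesis by auto
qed

text \<open>\<open>position\<close> is a number in base \<open>2 * M\<close> with one digit for each
  node of the path below the root; division by a power of the base drops the digits below the
  ancestor \<open>u\<close>.\<close>

lemma position_append_div:
  assumes "r \<in> nodes D \<rightarrow>\<^sub>E {..<M}" "length (z @ u) \<le> D"
  shows "position M r (z @ u) div (2 * M) ^ length z = position M r u"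
  using assms(2)
proof (induction z)
  case (Cons b z)
  let ?d = "(if b then M else 0) + r (b # z @ u)"
  have d: "?d < 2 * M" using digit_less[OF assms(1), of b "z @ u"] Cons.prems by simp
  have "position M r (b # z @ u) div (2 * M) = position M r (z @ u)"
    using d by (simp only: position.simps div_mult_self3 div_less)
  then have "position M r ((b # z) @ u) div (2 * M) ^ length (b # z) =
      position M r (z @ u) div (2 * M) ^ length z"
    by (simp only: append_Cons length_Cons power_Suc div_mult2_eq)
  then show ?case using Cons by simp
qed simp

lemma position_less:
  assumes "r \<in> nodes D \<rightarrow>\<^sub>E {..<M}" "length x \<le> D" "M > 0"
  shows "position M r x < (2 * M) ^ length x"
proof -
  have "position M r x div (2 * M) ^ length x = 0"
    using position_append_div[OF assms(1), of x "[]"] assms(2) by simp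
  then show ?thesis using assms(3) by (simp add: div_eq_0_iff)
qed

lemma position_inj:
  assumes "r \<in> nodes D \<rightarrow>\<^sub>E {..<M}" "length x \<le> D" "length x = length y" "position M r x = position M r y"
  shows "x = y"
  using assms(2-)
proof (induction x arbitrary: y)
  case (Cons b x)
  then obtain c y' where y: "y = c # y'" by (metis length_Suc_conv)
  have "position M r (b # x) div (2 * M) ^ 1 = position M r x"
    using position_append_div[OF assms(1), of "[b]" x] Cons.prems by simp
  moreover have "position M r (c # y') div (2 * M) ^ 1 = position M r y'"
    using position_append_div[OF assms(1), of "[c]" y'] Cons.prems y by simp
  ultimately have xy: "x = y'" using Cons y by simp
  have "b # x \<in> nodes D" "c # x \<in> nodes D" using Cons.prems by (auto simp: nodes_def)
  then have "r (b # x) < M" "r (c # x) < M" using assms(1) by auto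
  then show ?case using Cons.prems(3) unfolding y xy by (auto split: if_splits)
qed simp

section \<open>The union bound over the choices of blocks\<close>

text \<open>\<open>M_large\<close> is calibrated for a union bound: there are at most
  \<open>2 ^ (3 * D + 1)\<close> triples of a node and two leaves, and each of them is bad with
  probability at most \<open>C / M\<close>.\<close>

locale random_tree =
  fixes D M C :: nat and \<chi> :: "real set \<Rightarrow> bool" and p :: "nat \<Rightarrow> real"
  assumes few: "few_breaks C \<chi>"
    and mono: "strict_mono_on {..<(2 * M) ^ D} p"
    and M_large: "M > C * 2 ^ (3 * D + 1)"
begin

definition place :: "(bool list \<Rightarrow> nat) \<Rightarrow> bool list \<Rightarrow> real" where
  "place r x = p (position M r x)"

definition split_at :: "bool list \<Rightarrow> bool list \<Rightarrow> bool list \<Rightarrow> (bool list \<Rightarrow> nat) \<Rightarrow> bool" where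
  "split_at u y z r \<longleftrightarrow> (\<exists>x\<in>leaves D. \<exists>x'\<in>leaves D. suffix u x \<and> suffix u x' \<and>
     \<chi> {place r x, place r y, place r z} \<noteq> \<chi> {place r x', place r y, place r z})"

lemma place_less:
  assumes "r \<in> nodes D \<rightarrow>\<^sub>E {..<M}" "r' \<in> nodes D \<rightarrow>\<^sub>E {..<M}" "x \<in> leaves D" "x' \<in> leaves D"
    "suffix u x" "suffix u x'" "position M r u < position M r' u"
  shows "place r x < place r' x'"
proof -
  obtain zs zs' where zs: "x = zs @ u" "x' = zs' @ u" using assms(5,6) by (auto simp: suffix_def)
  have len: "length x = D" "length x' = D" using assms(3,4) by (auto simp: leaves_def)
  then have [simp]: "length zs' = length zs" using zs by auto
  have "position M r x div (2 * M) ^ length zs < position M r' x' div (2 * M) ^ length zs"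
    using position_append_div[OF assms(1), of zs u] position_append_div[OF assms(2), of zs' u]
      zs len assms(7) by simp
  then have "position M r x < position M r' x'" by (meson div_le_mono linorder_not_less)
  moreover have "position M r x < (2 * M) ^ D" "position M r' x' < (2 * M) ^ D"
    using position_less[OF assms(1), of x] position_less[OF assms(2), of x'] len M_large by auto
  ultimately show ?thesis using mono by (auto simp: place_def strict_mono_on_def)
qed

text \<open>With the choices away from \<open>u\<close> fixed, the points of \<open>y\<close> and
  \<open>z\<close> do not move. For every bad value \<open>a\<close>, some break of this pair lies
  between two points of the block given by \<open>a\<close>. The candidate blocks are disjoint, so
  different bad values have different breaks.\<close>

lemma card_split_values:
  assumes r: "r \<in> nodes D - {u} \<rightarrow>\<^sub>E {..<M}" and u: "u \<in> nodes D"
    and yz: "y \<in> leaves D" "z \<in> leaves D" "y \<noteq> z" "\<not> suffix u y" "\<not> suffix u z"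
  shows "card {a \<in> {..<M}. split_at u y z (r(u := a))} \<le> C"
proof (cases "M = 0")
  case False
  let ?r = "\<lambda>a. r(u := a)"
  let ?B = "{a \<in> {..<M}. split_at u y z (?r a)}"
  have r': "?r a \<in> nodes D \<rightarrow>\<^sub>E {..<M}" if "a < M" for a
    using PiE_fun_upd[of a "\<lambda>_. {..<M}" u r "nodes D - {u}"] r u that by (simp add: insert_absorb)
  define Y Z where "Y = place (?r 0) y" and "Z = place (?r 0) z"
  have Y: "place (?r a) y = Y" and Z: "place (?r a) z = Z" for a
    using yz by (simp_all add: Y_def Z_def place_def position_fun_upd)
  have "Y \<noteq> Z"
  proof -
    have lt: "position M (?r 0) y < (2 * M) ^ D" "position M (?r 0) z < (2 * M) ^ D"
      using position_less[OF r'[of 0], of y] position_less[OF r'[of 0], of z] yz False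
      by (auto simp: leaves_def)
    have "position M (?r 0) y \<noteq> position M (?r 0) z"
      using position_inj[OF r'[of 0], of y z] yz False by (auto simp: leaves_def)
    then show ?thesis
      using strict_mono_on_imp_inj_on[OF mono] lt by (auto simp: Y_def Z_def place_def inj_on_def)
  qed
  then obtain F where F: "finite F" "card F \<le> C"
    "\<And>x x'. x \<le> x' \<Longrightarrow> {x..x'} \<inter> F = {} \<Longrightarrow> \<chi> {x, Y, Z} = \<chi> {x', Y, Z}"
    using few unfolding few_breaks_def by metis
  define sep where "sep a \<phi> \<longleftrightarrow> (\<exists>x\<in>leaves D. \<exists>x'\<in>leaves D. suffix u x \<and> suffix u x' \<and>
      place (?r a) x \<le> \<phi> \<and> \<phi> \<le> place (?r a) x')" for a \<phi>
  have "\<exists>\<phi>. \<phi> \<in> F \<and> sep a \<phi>" if "a \<in> ?B" for a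
  proof -
    obtain x x' where x: "x \<in> leaves D" "x' \<in> leaves D" "suffix u x" "suffix u x'"
      "\<chi> {place (?r a) x, Y, Z} \<noteq> \<chi> {place (?r a) x', Y, Z}"
      using \<open>a \<in> ?B\<close> by (auto simp: split_at_def Y Z)
    show ?thesis
    proof (cases "place (?r a) x \<le> place (?r a) x'")
      case True
      then obtain \<phi> where "\<phi> \<in> {place (?r a) x..place (?r a) x'} \<inter> F" using F(3) x(5) by blast
      then show ?thesis using x(1-4) unfolding sep_def by (intro exI[of _ \<phi>]) auto
    next
      case False
      then have "{place (?r a) x'..place (?r a) x} \<inter> F \<noteq> {}"
        using F(3)[of "place (?r a) x'" "place (?r a) x"] x(5) by argo
      then obtain \<phi> where "\<phi> \<in> {place (?r a) x'..place (?r a) x} \<inter> F" by blast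
      then show ?thesis using x(1-4) unfolding sep_def by (intro exI[of _ \<phi>]) auto
    qed
  qed
  then have "\<exists>\<phi>. \<forall>a\<in>?B. \<phi> a \<in> F \<and> sep a (\<phi> a)" by (intro bchoice ballI)
  then obtain \<phi> where \<phi>: "\<And>a. a \<in> ?B \<Longrightarrow> \<phi> a \<in> F" "\<And>a. a \<in> ?B \<Longrightarrow> sep a (\<phi> a)"
    by blast
  have less: "\<phi> a < \<phi> a'" if a: "a \<in> ?B" "a' \<in> ?B" "a < a'" for a a'
  proof -
    \<comment> \<open>The position of the parent \<open>w\<close> does not depend on
      \<open>a\<close>, so the position of \<open>u\<close> is strictly increasing in
      \<open>a\<close>.\<close>
    obtain b w where bw: "u = b # w" using u by (cases u) (auto simp: nodes_def)
    have "position M (?r a) u < position M (?r a') u"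
      using a(3) position_fun_upd[of "b # w" w M r] by (simp add: bw suffix_def)
    moreover obtain x where "x \<in> leaves D" "suffix u x" "\<phi> a \<le> place (?r a) x"
      using \<phi>(2)[OF a(1)] unfolding sep_def by blast
    moreover obtain x' where "x' \<in> leaves D" "suffix u x'" "place (?r a') x' \<le> \<phi> a'"
      using \<phi>(2)[OF a(2)] unfolding sep_def by blast
    ultimately have "place (?r a) x < place (?r a') x'"
      using place_less[OF r' r'] a(1,2) by blast
    then show ?thesis
      using \<open>\<phi> a \<le> place (?r a) x\<close> \<open>place (?r a') x' \<le> \<phi> a'\<close> by linarith
  qed
  have "inj_on \<phi> ?B"
  proof (rule inj_onI, rule ccontr)
    fix a a' assume "a \<in> ?B" "a' \<in> ?B" "\<phi> a = \<phi> a'" "a \<noteq> a'"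
    then show False using less[of a a'] less[of a' a] by (cases "a < a'") auto
  qed
  then have "card ?B \<le> card F" using \<phi>(1) F(1) by (intro card_inj_on_le) auto
  then show ?thesis using F(2) by simp
qed simp

text \<open>The count for a fixed choice away from \<open>u\<close> is summed over all such choices.
  Relative to the \<open>M ^ card (nodes D)\<close> choices in all, a split has probability at most
  \<open>C / M\<close>.\<close>

lemma card_split_choices:
  assumes u: "u \<in> nodes D"
    and yz: "y \<in> leaves D" "z \<in> leaves D" "y \<noteq> z" "\<not> suffix u y" "\<not> suffix u z"
  shows "card {r \<in> nodes D \<rightarrow>\<^sub>E {..<M}. split_at u y z r} \<le> M ^ (card (nodes D) - 1) * C"
proof -
  let ?\<Omega> = "nodes D - {u} \<rightarrow>\<^sub>E {..<M}"
  let ?A = "SIGMA r:?\<Omega>. {a \<in> {..<M}. split_at u y z (r(u := a))}"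
  have fin: "finite ?\<Omega>" using finite_nodes by (intro finite_PiE) auto
  have "{r \<in> nodes D \<rightarrow>\<^sub>E {..<M}. split_at u y z r} \<subseteq> (\<lambda>(r, a). r(u := a)) ` ?A"
  proof
    fix r assume r: "r \<in> {r \<in> nodes D \<rightarrow>\<^sub>E {..<M}. split_at u y z r}"
    then have "(r(u := undefined), r u) \<in> ?A" using u by (auto simp: PiE_def extensional_def)
    moreover have "r = (\<lambda>(r, a). r(u := a)) (r(u := undefined), r u)" by simp
    ultimately show "r \<in> (\<lambda>(r, a). r(u := a)) ` ?A" by (rule rev_image_eqI)
  qed
  then have "card {r \<in> nodes D \<rightarrow>\<^sub>E {..<M}. split_at u y z r} \<le> card ?A"
    using fin by (intro surj_card_le) auto
  also have "\<dots> = (\<Sum>r\<in>?\<Omega>. card {a \<in> {..<M}. split_at u y z (r(u := a))})"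
    using fin by (intro card_SigmaI) auto
  also have "\<dots> \<le> card ?\<Omega> * C"
    using card_split_values[OF _ u yz] sum_bounded_above[of ?\<Omega> _ C] by simp
  also have "card ?\<Omega> = M ^ (card (nodes D) - 1)"
    using finite_nodes u by (simp add: card_PiE card_Diff_singleton)
  finally show ?thesis .
qed

lemma exists_unsplit:
  obtains r where "r \<in> nodes D \<rightarrow>\<^sub>E {..<M}"
    "\<And>u y z. u \<in> nodes D \<Longrightarrow> y \<in> leaves D \<Longrightarrow> z \<in> leaves D \<Longrightarrow> y \<noteq> z \<Longrightarrow>
       \<not> suffix u y \<Longrightarrow> \<not> suffix u z \<Longrightarrow> \<not> split_at u y z r"
proof -
  let ?\<Omega> = "nodes D \<rightarrow>\<^sub>E {..<M}"
  let ?I = "{(u, y, z) \<in> nodes D \<times> leaves D \<times> leaves D. y \<noteq> z \<and> \<not> suffix u y \<and> \<not> suffix u z}"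
  let ?bad = "\<lambda>(u, y, z). {r \<in> ?\<Omega>. split_at u y z r}"
  have Isub: "?I \<subseteq> nodes D \<times> leaves D \<times> leaves D" by auto
  have fin: "finite ?\<Omega>" using finite_nodes by (intro finite_PiE) auto
  have finI: "finite ?I" using finite_subset[OF Isub] finite_nodes finite_leaves by simp
  have "card ?I \<le> card (nodes D \<times> leaves D \<times> leaves D)"
    using Isub finite_nodes finite_leaves by (intro card_mono) auto
  also have "\<dots> \<le> 2 ^ (D + 1) * (2 ^ D * 2 ^ D)"
    using card_nodes_le by (simp add: card_cartesian_product card_leaves)
  also have "\<dots> = 2 ^ (3 * D + 1)"
    by (simp add: power_add[symmetric])
  finally have cI: "card ?I \<le> 2 ^ (3 * D + 1)" .
  have cO: "card ?\<Omega> = M ^ card (nodes D)" using finite_nodes by (simp add: card_PiE)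
  have "\<not> ?\<Omega> \<subseteq> (\<Union>i\<in>?I. ?bad i)"
  \<comment> \<open>For \<open>D = 0\<close> there are no bad events, and the exponent
    \<open>card (nodes D) - 1\<close> would be truncated to 0.\<close>
  proof (cases "nodes D = {}")
    case True
    then show ?thesis by auto
  next
    case False
    have finU: "finite (\<Union>i\<in>?I. ?bad i)" using finI fin by auto
    have "card (\<Union>i\<in>?I. ?bad i) \<le> (\<Sum>i\<in>?I. card (?bad i))" using finI by (rule card_UN_le)
    also have "\<dots> \<le> (\<Sum>i\<in>?I. M ^ (card (nodes D) - 1) * C)"
      using card_split_choices by (intro sum_mono) auto
    also have "\<dots> = card ?I * (M ^ (card (nodes D) - 1) * C)" by simp
    also have "\<dots> \<le> 2 ^ (3 * D + 1) * (M ^ (card (nodes D) - 1) * C)" using cI by (rule mult_right_mono) simp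
    also have "\<dots> = M ^ (card (nodes D) - 1) * (C * 2 ^ (3 * D + 1))" by (simp add: mult_ac)
    also have "\<dots> < M ^ (card (nodes D) - 1) * M" using M_large by (intro mult_strict_left_mono) auto
    also have "\<dots> = M ^ card (nodes D)"
      using False finite_nodes by (metis card_gt_0_iff power_minus_mult)
    finally have "card (\<Union>i\<in>?I. ?bad i) < card ?\<Omega>" unfolding cO .
    then show ?thesis using card_mono[OF finU, of ?\<Omega>] by linarith
  qed
  then obtain r where r: "r \<in> ?\<Omega>" "r \<notin> (\<Union>i\<in>?I. ?bad i)" unfolding subset_iff not_all not_imp by (elim exE conjE)
  show ?thesis
  proof (rule that[OF r(1)])
    fix u y z
    assume "u \<in> nodes D" "y \<in> leaves D" "z \<in> leaves D" "y \<noteq> z" "\<not> suffix u y" "\<not> suffix u z"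
    then have "(u, y, z) \<in> ?I" by simp
    then have "r \<notin> ?bad (u, y, z)" using r(2) by blast
    then show "\<not> split_at u y z r" using r(1) by simp
  qed
qed

lemma module_embedding:
  obtains g where "inj_on g (leaves D)" "g ` leaves D \<subseteq> p ` {..<(2 * M) ^ D}"
    "\<And>u x x' y z. {x, x', y, z} \<subseteq> leaves D \<Longrightarrow> suffix u x \<Longrightarrow> suffix u x' \<Longrightarrow> y \<noteq> z \<Longrightarrow>
       \<not> suffix u y \<Longrightarrow> \<not> suffix u z \<Longrightarrow> \<chi> {g x, g y, g z} = \<chi> {g x', g y, g z}"
proof -
  obtain r where r: "r \<in> nodes D \<rightarrow>\<^sub>E {..<M}"
    "\<And>u y z. u \<in> nodes D \<Longrightarrow> y \<in> leaves D \<Longrightarrow> z \<in> leaves D \<Longrightarrow> y \<noteq> z \<Longrightarrow>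
       \<not> suffix u y \<Longrightarrow> \<not> suffix u z \<Longrightarrow> \<not> split_at u y z r"
    using exists_unsplit by blast
  have lt: "position M r x < (2 * M) ^ D" if "x \<in> leaves D" for x
    using position_less[OF r(1), of x] that M_large by (auto simp: leaves_def)
  show ?thesis
  proof (rule that[of "place r"])
    show "inj_on (place r) (leaves D)"
    proof (rule inj_onI)
      fix x y assume xy: "x \<in> leaves D" "y \<in> leaves D" "place r x = place r y"
      then have "position M r x = position M r y"
        using strict_mono_on_imp_inj_on[OF mono] lt by (auto simp: place_def inj_on_def)
      then show "x = y" using position_inj[OF r(1)] xy by (auto simp: leaves_def)
    qed
    show "place r ` leaves D \<subseteq> p ` {..<(2 * M) ^ D}" using lt by (auto simp: place_def)
    fix u x x' y z
    assume a: "{x, x', y, z} \<subseteq> leaves D" "suffix u x" "suffix u x'" "y \<noteq> z" "\<not> suffix u y" "\<not> suffix u z"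
    \<comment> \<open>\<open>u\<close> is not the root, since the root is a suffix of
      \<open>y\<close>.\<close>
    have "u \<in> nodes D"
      using a suffix_length_le[of u x] by (auto simp: nodes_def leaves_def)
    then have "\<not> split_at u y z r" using r(2) a by blast
    then show "\<chi> {place r x, place r y, place r z} = \<chi> {place r x', place r y, place r z}"
      using a unfolding split_at_def by blast
  qed
qed

end

section \<open>Reduction of triples of leaves to comparable pairs of nodes\<close>

text \<open>Two configurations with the same nodes \<open>v\<close> and \<open>w\<close> are
  connected by exchanging their three leaves one after another. Each exchange takes place inside a
  subtree that the other two leaves avoid, so \<open>mod\<close> preserves the colour.\<close>

lemma tree_colouring_of_modules:
  assumes mod: "\<And>u x x' y z. {x, x', y, z} \<subseteq> leaves D \<Longrightarrow> suffix u x \<Longrightarrow> suffix u x' \<Longrightarrow> y \<noteq> z \<Longrightarrow>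
       \<not> suffix u y \<Longrightarrow> \<not> suffix u z \<Longrightarrow> \<chi> {x, y, z} = \<chi> {x', y, z}"
  shows "\<exists>R. tree_colouring D \<chi> R"
proof -
  \<comment> \<open>The configuration is oriented, with \<open>x\<close> below the
    \<open>False\<close> child and \<open>y\<close> below the \<open>True\<close> child of
    \<open>w\<close>, so that corresponding leaves lie in the same subtree. The other orientation is
    reduced to this one at the end.\<close>
  define conf where "conf v w x y z \<longleftrightarrow> {x, y, z} \<subseteq> leaves D \<and> suffix (False # w) x \<and> suffix (True # w) y \<and>
     (\<exists>b. suffix (b # v) w \<and> suffix ((\<not> b) # v) z)" for v w x y z
  have same: "\<chi> {x, y, z} = \<chi> {x', y', z'}" if c: "conf v w x y z" "conf v w x' y' z'" for v w x y z x' y' z'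
  proof -
    have leaf: "{x, y, z, x', y', z'} \<subseteq> leaves D"
      and xy: "suffix (False # w) x" "suffix (True # w) y" "suffix (False # w) x'" "suffix (True # w) y'"
      using c by (auto simp: conf_def)
    obtain b where b: "suffix (b # v) w" "suffix ((\<not> b) # v) z" using c(1) unfolding conf_def by blast
    obtain b2 where b2: "suffix (b2 # v) w" "suffix ((\<not> b2) # v) z'" using c(2) unfolding conf_def by blast
    have b': "suffix ((\<not> b) # v) z'" using b2(2) suffix_Cons_unique[OF b2(1) b(1)] by simp
    have low: "suffix (b # v) (d # w)" for d using b(1) by (rule suffix_ConsI)
    have above: "\<not> suffix (d # w) t" if "suffix ((\<not> b) # v) t" for d t
    proof
      assume "suffix (d # w) t"
      with low have "suffix (b # v) t" by (rule suffix_order.trans)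
      from suffix_Cons_unique[OF this that] show False by simp
    qed
    have apart: "\<not> suffix (d # w) t" if "suffix ((\<not> d) # w) t" for d t
      using suffix_Cons_unique[OF that] by auto
    have "\<chi> {x, y, z} = \<chi> {x', y, z}"
    proof (rule mod)
      show "y \<noteq> z" using xy(2) above[OF b(2)] by blast
      show "\<not> suffix (False # w) y" using apart[of False] xy(2) by simp
    qed (use leaf xy above[OF b(2)] in auto)
    also have "\<dots> = \<chi> {y, x', z}" by (simp add: insert_commute)
    also have "\<dots> = \<chi> {y', x', z}"
    proof (rule mod)
      show "x' \<noteq> z" using xy(3) above[OF b(2)] by blast
      show "\<not> suffix (True # w) x'" using apart[of True] xy(3) by simp
    qed (use leaf xy above[OF b(2)] in auto)
    also have "\<dots> = \<chi> {z, x', y'}" by (simp add: insert_commute)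
    also have "\<dots> = \<chi> {z', x', y'}"
    proof (rule mod)
      show "x' \<noteq> y'" using xy(3,4) apart[of False y'] by auto
    qed (use leaf xy b(2) b' above in blast)+
    also have "\<dots> = \<chi> {x', y', z'}" by (simp add: insert_commute)
    finally show ?thesis .
  qed
  define R where "R v w \<longleftrightarrow> (\<exists>x y z. conf v w x y z \<and> \<chi> {x, y, z})" for v w
  have R: "\<chi> {x, y, z} = R v w" if "conf v w x y z" for v w x y z
    using same[OF that] that unfolding R_def by blast
  have "tree_colouring D \<chi> R"
  proof
    fix x y z b v w
    assume a: "x \<in> leaves D" "y \<in> leaves D" "z \<in> leaves D" "suffix (b # v) w" "meets_at w x y"
      "suffix ((\<not> b) # v) z"
    from a(5) consider "suffix (False # w) x" "suffix (True # w) y" | "suffix (False # w) y" "suffix (True # w) x"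
      unfolding meets_at_def by (metis (full_types, lifting))
    then show "\<chi> {x, y, z} = R v w"
    proof cases
      case 1
      then show ?thesis using a by (intro R) (auto simp: conf_def)
    next
      case 2
      then have "\<chi> {y, x, z} = R v w" using a by (intro R) (auto simp: conf_def)
      then show ?thesis by (simp add: insert_commute)
    qed
  qed
  then show ?thesis by blast
qed

lemma few_breaks_ramsey:
  assumes "few_breaks C \<chi>" "finite X" "card X = (2 * M) ^ D" "M > C * 2 ^ (3 * D + 1)"
    and "D \<ge> (2 * q) ^ r" "q > 0"
  shows "(\<exists>Y\<subseteq>X. card Y = Suc r \<and> (\<forall>T\<subseteq>Y. card T = 3 \<longrightarrow> \<chi> T)) \<or>
         (\<exists>Y\<subseteq>X. card Y = 2 ^ q \<and> (\<forall>T\<subseteq>Y. card T = 3 \<longrightarrow> \<not> \<chi> T))"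
proof -
  let ?p = "\<lambda>i. sorted_list_of_set X ! i"
  have "strict_mono_on {..<(2 * M) ^ D} ?p"
    using assms(2,3) strict_sorted_list_of_set[of X]
    by (auto simp: strict_mono_on_def sorted_wrt_iff_nth_less)
  then interpret random_tree D M C \<chi> ?p
    using assms by unfold_locales
  have pX: "?p ` {..<(2 * M) ^ D} \<subseteq> X"
    using assms(2,3) nth_mem[of _ "sorted_list_of_set X"] by auto
  obtain g where g: "inj_on g (leaves D)" "g ` leaves D \<subseteq> ?p ` {..<(2 * M) ^ D}"
    "\<And>u x x' y z. {x, x', y, z} \<subseteq> leaves D \<Longrightarrow> suffix u x \<Longrightarrow> suffix u x' \<Longrightarrow> y \<noteq> z \<Longrightarrow>
       \<not> suffix u y \<Longrightarrow> \<not> suffix u z \<Longrightarrow> \<chi> {g x, g y, g z} = \<chi> {g x', g y, g z}"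
    using module_embedding by blast
  obtain R where "tree_colouring D (\<lambda>T. \<chi> (g ` T)) R"
    using tree_colouring_of_modules[of D "\<lambda>T. \<chi> (g ` T)"] g(3) by auto
  then interpret tree_colouring D "\<lambda>T. \<chi> (g ` T)" R .
  have "\<exists>Y\<subseteq>X. card Y = card S \<and> (\<forall>T\<subseteq>Y. card T = 3 \<longrightarrow> \<chi> T = c)"
    if S: "S \<subseteq> leaves D" "homogeneous_leaves (\<lambda>T. \<chi> (g ` T)) c UNIV S" for S c
  proof (intro exI[of _ "g ` S"] conjI allI impI)
    show "g ` S \<subseteq> X" using S(1) g(2) pX by blast
    have inj: "inj_on g S" using g(1) S(1) by (rule inj_on_subset)
    then show "card (g ` S) = card S" by (rule card_image)
    fix T assume T: "T \<subseteq> g ` S" "card T = 3"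
    then obtain T' where T': "T' \<subseteq> S" "T = g ` T'" by (meson subset_imageE)
    then have "card T' = 3" using T(2) inj by (metis card_image inj_on_subset)
    then obtain x y z where "T' = {x, y, z}" "x \<noteq> y" "x \<noteq> z" "y \<noteq> z"
      by (auto simp: card_3_iff)
    then show "\<chi> T = c" using S(2) T' unfolding homogeneous_leaves_def by auto
  qed
  then show ?thesis using tree_ramsey[OF assms(5,6)] by (metis (full_types))
qed

subsection \<open>The Ramsey bound\<close>

lemma increasing_tuples_mono: "S \<subseteq> S' \<Longrightarrow> increasing_tuples k S \<subseteq> increasing_tuples k S'"
  by (auto simp: increasing_tuples_def)

text \<open>Passes from values to indices: by injectivity an increasing tuple of \<open>k\<close>
  indices has \<open>k\<close> distinct values, so its colour is that of a \<open>k\<close>-element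
  subset of \<open>Y\<close>.\<close>

lemma homogeneous_pull_back:
  assumes "inj_on a J" "Y \<subseteq> a ` J" "\<And>T. T \<subseteq> Y \<Longrightarrow> card T = k \<Longrightarrow> \<chi> T = c"
    and "\<And>js. js \<in> increasing_tuples k J \<Longrightarrow> Q (map a js) = \<chi> (set (map a js))"
  shows "\<exists>S\<subseteq>J. card S = card Y \<and> (\<forall>js\<in>increasing_tuples k S. Q (map a js) = c)"
proof -
  obtain S where S: "S \<subseteq> J" "Y = a ` S" using assms(2) by (meson subset_imageE)
  have "card S = card Y" using assms(1) S by (metis card_image inj_on_subset)
  moreover have "Q (map a js) = c" if js: "js \<in> increasing_tuples k S" for js
  proof -
    have "set js \<subseteq> S" "length js = k" "distinct js"
      using js strict_sorted_iff by (auto simp: increasing_tuples_def)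
    moreover have "inj_on a (set js)" using assms(1) S(1) \<open>set js \<subseteq> S\<close> by (meson inj_on_subset)
    ultimately have "a ` set js \<subseteq> Y" "card (a ` set js) = k"
      using S(2) by (auto simp: card_image distinct_card)
    then show ?thesis
      using assms(3)[of "a ` set js"] assms(4)[of js] js increasing_tuples_mono[OF S(1)] by auto
  qed
  ultimately show ?thesis using S(1) by blast
qed

lemma monotone_points_ramsey:
  fixes a :: "nat \<Rightarrow> real"
  assumes "few_breaks C \<chi>" "M > C * 2 ^ (3 * D + 1)" "D \<ge> (2 * q) ^ r" "q > 0" "n \<le> 2 ^ q"
    and J: "finite J" "card J = (2 * M) ^ D" "inj_on a J"
    and Q: "\<And>js. js \<in> increasing_tuples 3 J \<Longrightarrow> Q (map a js) = \<chi> (set (map a js))"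
  shows "(\<exists>S\<subseteq>J. card S = Suc r \<and> (\<forall>js\<in>increasing_tuples 3 S. Q (map a js))) \<or>
         (\<exists>S\<subseteq>J. card S = n \<and> (\<forall>js\<in>increasing_tuples 3 S. \<not> Q (map a js)))"
proof -
  have pull: "\<exists>S\<subseteq>J. card S = card Y \<and> (\<forall>js\<in>increasing_tuples 3 S. Q (map a js) = c)"
    if "Y \<subseteq> a ` J" "\<And>T. T \<subseteq> Y \<Longrightarrow> card T = 3 \<Longrightarrow> \<chi> T = c" for Y c
    using homogeneous_pull_back[of a J Y 3 \<chi> c Q] J(3) that Q by blast
  have "(\<exists>Y\<subseteq>a ` J. card Y = Suc r \<and> (\<forall>T\<subseteq>Y. card T = 3 \<longrightarrow> \<chi> T)) \<or>
        (\<exists>Y\<subseteq>a ` J. card Y = 2 ^ q \<and> (\<forall>T\<subseteq>Y. card T = 3 \<longrightarrow> \<not> \<chi> T))"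
    using assms(1-4) J by (intro few_breaks_ramsey) (auto simp: card_image)
  then show ?thesis
  proof
    assume "\<exists>Y\<subseteq>a ` J. card Y = Suc r \<and> (\<forall>T\<subseteq>Y. card T = 3 \<longrightarrow> \<chi> T)"
    then obtain Y where Y: "Y \<subseteq> a ` J" "card Y = Suc r" "\<And>T. T \<subseteq> Y \<Longrightarrow> card T = 3 \<Longrightarrow> \<chi> T = True"
      by blast
    from pull[OF Y(1,3)] show ?thesis unfolding Y(2) by simp
  next
    assume "\<exists>Y\<subseteq>a ` J. card Y = 2 ^ q \<and> (\<forall>T\<subseteq>Y. card T = 3 \<longrightarrow> \<not> \<chi> T)"
    then obtain Y where Y: "Y \<subseteq> a ` J" "card Y = 2 ^ q" "\<And>T. T \<subseteq> Y \<Longrightarrow> card T = 3 \<Longrightarrow> \<chi> T = False"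
      by blast
    from pull[OF Y(1,3)] obtain S where
      S: "S \<subseteq> J" "card S = 2 ^ q" "\<forall>js\<in>increasing_tuples 3 S. \<not> Q (map a js)"
      unfolding Y(2) by auto
    have "n \<le> card S" using S(2) assms(5) by simp
    then obtain S' where S': "S' \<subseteq> S" "card S' = n" by (rule obtain_subset_with_card_n)
    then have "\<forall>js\<in>increasing_tuples 3 S'. \<not> Q (map a js)"
      using S(3) increasing_tuples_mono[of S' S 3] by blast
    then show ?thesis using S(1) S' by (intro disjI2 exI[of _ S']) auto
  qed
qed

text \<open>Two applications of \<open>chain_or_antichain\<close>. As
  \<open>m ^ 3 > (m - 1) * (m ^ 2 - 1)\<close>, there are \<open>m\<close> strictly increasing or
  \<open>m ^ 2\<close> weakly decreasing terms; as \<open>m ^ 2 > (m - 1) * (m - 1)\<close>, the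
  latter contain \<open>m\<close> strictly decreasing or \<open>m\<close> equal ones.\<close>

lemma strictly_monotone_or_constant:
  fixes a :: "nat \<Rightarrow> real"
  assumes "m > 0"
  obtains (inc) J where "J \<subseteq> {..<m ^ 3}" "card J = m" "\<And>i j. i \<in> J \<Longrightarrow> j \<in> J \<Longrightarrow> i < j \<Longrightarrow> a i < a j"
  | (dec) J where "J \<subseteq> {..<m ^ 3}" "card J = m" "\<And>i j. i \<in> J \<Longrightarrow> j \<in> J \<Longrightarrow> i < j \<Longrightarrow> a j < a i"
  | (const) J where "J \<subseteq> {..<m ^ 3}" "card J = m" "\<And>i j. i \<in> J \<Longrightarrow> j \<in> J \<Longrightarrow> a i = a j"
proof -
  obtain k where k: "m = Suc k" using assms by (metis gr0_implies_Suc)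
  have "k * (m ^ 2 - 1) \<le> k * m ^ 2" by simp
  also have "\<dots> < m ^ 3" by (simp add: k power2_eq_square power3_eq_cube)
  finally have "card {..<m ^ 3} > k * (m ^ 2 - 1)" by simp
  then have "(\<exists>J\<subseteq>{..<m ^ 3}. card J = Suc k \<and> (\<forall>i\<in>J. \<forall>j\<in>J. i < j \<longrightarrow> a i < a j)) \<or>
    (\<exists>J\<subseteq>{..<m ^ 3}. card J = Suc (m ^ 2 - 1) \<and> (\<forall>i\<in>J. \<forall>j\<in>J. i < j \<longrightarrow> a i \<ge> a j))"
    by (intro chain_or_antichain) (auto simp: transp_def)
  then show ?thesis
  proof
    assume "\<exists>J\<subseteq>{..<m ^ 3}. card J = Suc k \<and> (\<forall>i\<in>J. \<forall>j\<in>J. i < j \<longrightarrow> a i < a j)"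
    then show ?thesis using inc k by blast
  next
    assume "\<exists>J\<subseteq>{..<m ^ 3}. card J = Suc (m ^ 2 - 1) \<and> (\<forall>i\<in>J. \<forall>j\<in>J. i < j \<longrightarrow> a i \<ge> a j)"
    then obtain I where I: "I \<subseteq> {..<m ^ 3}" "card I = m ^ 2" "\<forall>i\<in>I. \<forall>j\<in>I. i < j \<longrightarrow> a i \<ge> a j"
      using assms by auto
    have "card I > k * k" using I(2) by (simp add: k power2_eq_square)
    then have "(\<exists>J\<subseteq>I. card J = Suc k \<and> (\<forall>i\<in>J. \<forall>j\<in>J. i < j \<longrightarrow> a i > a j)) \<or>
      (\<exists>J\<subseteq>I. card J = Suc k \<and> (\<forall>i\<in>J. \<forall>j\<in>J. i < j \<longrightarrow> a i = a j))"
      using I(3) finite_subset[OF I(1)] by (intro chain_or_antichain) (force simp: transp_def)+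
    then show ?thesis
    proof
      assume "\<exists>J\<subseteq>I. card J = Suc k \<and> (\<forall>i\<in>J. \<forall>j\<in>J. i < j \<longrightarrow> a i > a j)"
      then show ?thesis using dec k I(1) by (meson subset_trans)
    next
      assume "\<exists>J\<subseteq>I. card J = Suc k \<and> (\<forall>i\<in>J. \<forall>j\<in>J. i < j \<longrightarrow> a i = a j)"
      then obtain J where J: "J \<subseteq> I" "card J = Suc k" "\<forall>i\<in>J. \<forall>j\<in>J. i < j \<longrightarrow> a i = a j" by blast
      then have "a i = a j" if "i \<in> J" "j \<in> J" for i j
        using that by (metis linorder_neqE_nat)
      then show ?thesis using const[of J] J(1,2) I(1) k by blast
    qed
  qed
qed

text \<open>The cube pays for the passage to a monotone or constant subsequence. Along an increasing
  one a triple is the sorted list of its set, along a decreasing one the reverse of that list, so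
  its colour depends on the set alone. Along a constant one all triples coincide, and
  \<open>large\<close> provides enough members.\<close>

lemma sequence_ramsey:
  fixes a :: "nat \<Rightarrow> real"
  assumes Q: "few_coordinate_breaks 3 C Q" and M: "M > (3 * C + 2) * 2 ^ (3 * D + 1)"
    and q: "D \<ge> (2 * q) ^ r" "q > 0" "n \<le> 2 ^ q" and large: "Suc r \<le> (2 * M) ^ D" "n \<le> (2 * M) ^ D"
  shows "(\<exists>S\<subseteq>{..<((2 * M) ^ D) ^ 3}. card S = Suc r \<and> (\<forall>js\<in>increasing_tuples 3 S. Q (map a js))) \<or>
         (\<exists>S\<subseteq>{..<((2 * M) ^ D) ^ 3}. card S = n \<and> (\<forall>js\<in>increasing_tuples 3 S. \<not> Q (map a js)))"
proof -
  have pos: "(2 * M) ^ D > 0" using M by auto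
  have from_monotone: ?thesis if J: "J \<subseteq> {..<((2 * M) ^ D) ^ 3}" "card J = (2 * M) ^ D" "inj_on a J"
    and \<chi>: "few_breaks (3 * C + 2) \<chi>"
      "\<And>js. js \<in> increasing_tuples 3 J \<Longrightarrow> Q (map a js) = \<chi> (set (map a js))" for J \<chi>
  proof -
    have "finite J" using J(1) by (rule finite_subset) simp
    have "(\<exists>S\<subseteq>J. card S = Suc r \<and> (\<forall>js\<in>increasing_tuples 3 S. Q (map a js))) \<or>
         (\<exists>S\<subseteq>J. card S = n \<and> (\<forall>js\<in>increasing_tuples 3 S. \<not> Q (map a js)))"
      using \<chi>(2) by (intro monotone_points_ramsey[OF \<chi>(1) M q \<open>finite J\<close> J(2,3)])
    moreover have "S \<subseteq> {..<((2 * M) ^ D) ^ 3}" if "S \<subseteq> J" for S using that J(1) by (rule subset_trans)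
    ultimately show ?thesis by (elim disj_forward ex_forward conj_forward)
  qed
  from pos show ?thesis
  proof (cases rule: strictly_monotone_or_constant[where a = a])
    case (inc J)
    have "Q (map a js) = Q (sorted_list_of_set (set (map a js)))" if "js \<in> increasing_tuples 3 J" for js
    proof -
      have "sorted_wrt (<) (map a js)"
        using that inc(3) by (auto simp: increasing_tuples_def sorted_wrt_map intro: sorted_wrt_mono_rel)
      then show ?thesis by (metis strict_sorted_iff sorted_list_of_set.idem_if_sorted_distinct)
    qed
    moreover have "inj_on a J" using inc(3) by (intro linorder_inj_onI) force+
    ultimately show ?thesis
      using inc(1,2) few_breaks_sorted_list_of_set[OF Q] by (intro from_monotone[of J])
  next
    case (dec J)
    have "Q (map a js) = Q (rev (sorted_list_of_set (set (map a js))))" if "js \<in> increasing_tuples 3 J" for js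
    proof -
      have "sorted_wrt (<) (rev (map a js))"
        using that dec(3) unfolding sorted_wrt_rev
        by (auto simp: increasing_tuples_def sorted_wrt_map intro: sorted_wrt_mono_rel)
      then have "sorted_list_of_set (set (rev (map a js))) = rev (map a js)"
        by (metis strict_sorted_iff sorted_list_of_set.idem_if_sorted_distinct)
      then show ?thesis by simp
    qed
    moreover have "inj_on a J" using dec(3) by (intro linorder_inj_onI) force+
    ultimately show ?thesis
      using dec(1,2) few_breaks_sorted_list_of_set[OF few_coordinate_breaks_rev[OF Q]]
      by (intro from_monotone[of J])
  next
    case (const J)
    then have "J \<noteq> {}" using pos by auto
    then obtain j where j: "j \<in> J" by blast
    have Qj: "Q (map a js) = Q (replicate 3 (a j))" if "js \<in> increasing_tuples 3 J" for js
    proof -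
      have "map a js = map (\<lambda>_. a j) js"
        using that const(3)[OF _ j] by (intro map_cong) (auto simp: increasing_tuples_def)
      then show ?thesis using that by (simp add: increasing_tuples_def map_replicate_const)
    qed
    obtain S where S: "S \<subseteq> J" "card S = Suc r"
      using large(1) unfolding const(2)[symmetric] by (rule obtain_subset_with_card_n)
    obtain T where T: "T \<subseteq> J" "card T = n"
      using large(2) unfolding const(2)[symmetric] by (rule obtain_subset_with_card_n)
    show ?thesis
    proof (cases "Q (replicate 3 (a j))")
      case True
      then have "\<forall>js\<in>increasing_tuples 3 S. Q (map a js)"
        using Qj increasing_tuples_mono[OF S(1), of 3] by blast
      then show ?thesis using S const(1) by (intro disjI1 exI[of _ S]) auto
    next
      case False
      then have "\<forall>js\<in>increasing_tuples 3 T. \<not> Q (map a js)"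
        using Qj increasing_tuples_mono[OF T(1), of 3] by blast
      then show ?thesis using T const(1) by (intro disjI2 exI[of _ T]) auto
    qed
  qed
qed

text \<open>A point of the line is a one-element list, so \<open>concat\<close> turns a triple into
  the list of its three coordinates. The \<open>t\<close> polynomials of degree at most
  \<open>t\<close> give at most \<open>t * t\<close> breaks on a coordinate line.\<close>

lemma semialg_ramsey_propertyI:
  assumes M: "M > (3 * (t * t) + 2) * 2 ^ (3 * D + 1)"
    and "D \<ge> (2 * q) ^ r" "q > 0" "n \<le> 2 ^ q" "Suc r \<le> (2 * M) ^ D" "n \<le> (2 * M) ^ D"
  shows "semialg_ramsey_property 1 t 3 (Suc r) n (((2 * M) ^ D) ^ 3)"
  unfolding semialg_ramsey_property_def
proof (intro allI impI, elim conjE)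
  let ?N = "((2 * M) ^ D) ^ 3"
  fix P E
  assume P: "length P = ?N" "set P \<subseteq> euclidean_points 1" and E: "semialg_relation 1 3 t P E"
  define a where "a j = hd (P ! j)" for j
  have a: "P ! j = [a j]" if "j < ?N" for j
  proof -
    have "P ! j \<in> euclidean_points 1" using P that nth_mem[of j P] by auto
    then show ?thesis unfolding a_def by (cases "P ! j") (auto simp: euclidean_points_def)
  qed
  obtain fs \<Phi> where fs: "length fs = t" "\<And>f. f \<in> set fs \<Longrightarrow> poly_in_vars 3 f \<and> total_degree_le t f"
    "\<And>p. p \<in> point_tuples 3 P {..<?N} \<Longrightarrow> p \<in> E \<longleftrightarrow> concat p \<in> semialg_set 3 fs \<Phi>"
    using E P(1) unfolding semialg_relation_def by auto
  define Q where "Q x = \<Phi> (map (\<lambda>f. rpoly_eval f x \<ge> 0) fs)" for x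
  have "few_coordinate_breaks 3 (t * t) Q"
    using few_coordinate_breaks_semialg[of fs 3 t \<Phi>] fs(1,2) by (simp add: Q_def[abs_def])
  note main = sequence_ramsey[OF this assms, of a]
  have tuple: "map (\<lambda>j. P ! j) js \<in> E \<longleftrightarrow> Q (map a js)"
    if "js \<in> increasing_tuples 3 S" "S \<subseteq> {..<?N}" for js S
  proof -
    have js: "set js \<subseteq> {..<?N}" "length js = 3" using that by (auto simp: increasing_tuples_def)
    then have "map (\<lambda>j. P ! j) js = map (\<lambda>j. [a j]) js" by (intro map_cong) (auto simp: a)
    then have "concat (map (\<lambda>j. P ! j) js) = map a js" by (simp only: concat_map_singleton)
    moreover have "map (\<lambda>j. P ! j) js \<in> point_tuples 3 P {..<?N}"
      using that increasing_tuples_mono unfolding point_tuples_def by blast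
    ultimately show ?thesis
      using fs(3) js(2) by (simp add: semialg_set_def euclidean_points_def Q_def)
  qed
  from main show "(\<exists>S\<subseteq>{..<?N}. card S = Suc r \<and> point_tuples 3 P S \<subseteq> E) \<or>
      (\<exists>S\<subseteq>{..<?N}. card S = n \<and> point_tuples 3 P S \<inter> E = {})"
  proof (elim disjE exE conjE)
    fix S assume "S \<subseteq> {..<?N}" "card S = Suc r" "\<forall>js\<in>increasing_tuples 3 S. Q (map a js)"
    then have "point_tuples 3 P S \<subseteq> E" using tuple unfolding point_tuples_def by blast
    then show ?thesis using \<open>S \<subseteq> {..<?N}\<close> \<open>card S = Suc r\<close> by blast
  next
    fix S assume "S \<subseteq> {..<?N}" "card S = n" "\<forall>js\<in>increasing_tuples 3 S. \<not> Q (map a js)"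
    then have "point_tuples 3 P S \<inter> E = {}" using tuple unfolding point_tuples_def by blast
    then show ?thesis using \<open>S \<subseteq> {..<?N}\<close> \<open>card S = n\<close> by blast
  qed
qed

lemma semialg_ramsey_property_two: "semialg_ramsey_property d t 3 s 2 2"
proof -
  have "increasing_tuples 3 {..<2::nat} = {}"
  proof -
    have False if "js \<in> increasing_tuples 3 {..<2::nat}" for js
    proof -
      have "card (set js) = 3" "set js \<subseteq> {..<2}"
        using that strict_sorted_iff[of js] distinct_card[of js] by (simp_all add: increasing_tuples_def)
      then show False using card_mono[of "{..<2::nat}" "set js"] by simp
    qed
    then show ?thesis by blast
  qed
  then have "card {..<2::nat} = 2 \<and> point_tuples 3 P {..<2} \<inter> E = {}" for P :: "real list list" and E
    by (simp add: point_tuples_def)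
  then show ?thesis unfolding semialg_ramsey_property_def by blast
qed

section \<open>Numerical estimates and the final bound\<close>

lemma semialg_ramsey_le:
  "semialg_ramsey_property d t k s n N \<Longrightarrow> ereal_of_enat (semialg_ramsey d t k s n) \<le> ereal (real N)"
proof -
  assume "semialg_ramsey_property d t k s n N"
  then have "semialg_ramsey d t k s n \<le> enat N" unfolding semialg_ramsey_def by (intro INF_lower) simp
  then have "ereal_of_enat (semialg_ramsey d t k s n) \<le> ereal_of_enat (enat N)"
    by (simp only: ereal_of_enat_le_iff)
  then show ?thesis by simp
qed

text \<open>The left-hand side is the exponent of 2 in the final number of points. Since
  \<open>D\<close> is at most \<open>(4 * L) ^ r\<close> for \<open>L = log 2 n\<close>, it is at
  most \<open>K * L ^ (2 * r)\<close>. The factor \<open>K\<close> is then moved into the exponent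
  of \<open>L\<close>.\<close>

lemma polylog_bound:
  fixes r \<kappa> n q :: nat
  defines "q \<equiv> nat \<lceil>log 2 (real n)\<rceil>" and "D \<equiv> (2 * q) ^ r"
    and "K \<equiv> 3 * (real \<kappa> + 5) * 16 ^ r"
  assumes n: "n \<ge> 3"
  shows "real (3 * (D * (\<kappa> + 3 * D + 2))) \<le> log 2 (real n) powr (2 * real r + log (log 2 3) K)"
proof -
  define L where "L = log 2 (real n)"
  have l3: "1 < log 2 (3::real)" by (simp add: less_log_iff)
  have L: "log 2 3 \<le> L" using n by (simp add: L_def)
  then have Lpos: "L > 0" using l3 by linarith
  \<comment> \<open>Rounding up adds less than 1, and \<open>L > 1\<close>.\<close>
  have q: "real q \<le> 2 * L" using L l3 unfolding q_def L_def[symmetric] by linarith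
  have "q \<ge> 1" using L l3 unfolding q_def L_def[symmetric] by linarith
  then have D1: "D \<ge> 1" by (simp add: D_def)
  have "real D = (2 * real q) ^ r" by (simp add: D_def)
  also have "\<dots> \<le> (4 * L) ^ r" using q by (intro power_mono) auto
  finally have "real D ^ 2 \<le> ((4 * L) ^ r) ^ 2" by (intro power_mono) auto
  also have "\<dots> = 16 ^ r * L powr (2 * real r)"
  proof -
    have "((4 * L) ^ r) ^ 2 = ((4 * L) ^ 2) ^ r" by (simp only: power_mult[symmetric] mult.commute)
    also have "\<dots> = 16 ^ r * L ^ (2 * r)" by (simp add: power_mult_distrib power_mult)
    also have "L ^ (2 * r) = L powr real (2 * r)" using Lpos by (simp only: powr_realpow)
    finally show ?thesis by simp
  qed
  finally have D2: "real D ^ 2 \<le> 16 ^ r * L powr (2 * real r)" .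
  have K: "K \<ge> 1"
  proof -
    have "1 * 1 \<le> (3 * (real \<kappa> + 5)) * 16 ^ r" by (intro mult_mono) auto
    then show ?thesis by (simp add: K_def)
  qed
  have "D * (\<kappa> + 3 * D + 2) \<le> D * ((\<kappa> + 5) * D)"
  proof (intro mult_left_mono)
    have "\<kappa> * 1 \<le> \<kappa> * D" using D1 by (intro mult_left_mono) auto
    then show "\<kappa> + 3 * D + 2 \<le> (\<kappa> + 5) * D" using D1 unfolding add_mult_distrib by linarith
  qed simp
  then have "3 * (D * (\<kappa> + 3 * D + 2)) \<le> 3 * (D * ((\<kappa> + 5) * D))" by (rule mult_left_mono) simp
  also have "\<dots> = 3 * (\<kappa> + 5) * D ^ 2" by (simp only: power2_eq_square mult_ac)
  finally have "real (3 * (D * (\<kappa> + 3 * D + 2))) \<le> real (3 * (\<kappa> + 5) * D ^ 2)" by (rule of_nat_mono)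
  also have "\<dots> = 3 * (real \<kappa> + 5) * real D ^ 2" by simp
  also have "\<dots> \<le> 3 * (real \<kappa> + 5) * (16 ^ r * L powr (2 * real r))"
    using D2 by (intro mult_left_mono) auto
  also have "\<dots> = L powr (2 * real r) * K" by (simp add: K_def)
  \<comment> \<open>As a power of \<open>log 2 3 > 1\<close> the constant \<open>K\<close> has a
    nonnegative exponent, so passing to the base \<open>L\<close>, which is at least as large, does
    not decrease it.\<close>
  also have "K \<le> L powr (log (log 2 3) K)"
  proof -
    have "K = log 2 3 powr (log (log 2 3) K)"
      using l3 K powr_log_cancel[of "log 2 3" K] by linarith
    also have "\<dots> \<le> L powr (log (log 2 3) K)"
      using L l3 K by (intro powr_mono2) (auto simp: zero_le_log_cancel_iff)
    finally show ?thesis .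
  qed
  finally show ?thesis by (simp add: L_def powr_add mult_left_mono)
qed

theorem theorem5:
  fixes s t :: nat
  assumes "s \<ge> 4" and "t \<ge> 1"
  shows "\<exists>c::real. \<forall>n::nat. n \<ge> 2 \<longrightarrow>
    ereal_of_enat (semialg_ramsey 1 t 3 s n) \<le> ereal (2 powr ((log 2 (real n)) powr c))"
proof -
  \<comment> \<open>A red chain of \<open>r\<close> nodes yields \<open>r + 1\<close>
    points.\<close>
  define r where "r = s - 1"
  have s: "s = Suc r" "r \<ge> 1" using assms(1) by (auto simp: r_def)
  \<comment> \<open>Chosen so that \<open>2 ^ \<kappa>\<close> exceeds both the number of breaks
    \<open>3 * (t * t) + 2\<close> and \<open>s\<close>.\<close>
  define \<kappa> where "\<kappa> = 3 * (t * t) + 2 + s"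
  have \<kappa>: "3 * (t * t) + 2 < 2 ^ \<kappa>" "s \<le> 2 ^ \<kappa>"
    using less_exp[of \<kappa>] by (auto simp: \<kappa>_def)
  define c where "c = 2 * real r + log (log 2 3) (3 * (real \<kappa> + 5) * 16 ^ r)"
  have "ereal_of_enat (semialg_ramsey 1 t 3 s n) \<le> ereal (2 powr ((log 2 (real n)) powr c))"
    if n: "n \<ge> 3" for n
  proof -
    define q where "q = nat \<lceil>log 2 (real n)\<rceil>"
    define D where "D = (2 * q) ^ r"
    \<comment> \<open>Large enough for the union bound, and a power of 2, so that the number of
      points is a power of 2 with an explicit exponent.\<close>
    define M :: nat where "M = 2 ^ (\<kappa> + 3 * D + 1)"
    have q: "q > 0" using n by (simp add: q_def)
    have nq: "n \<le> 2 ^ q"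
    proof -
      have "real n = 2 powr log 2 (real n)" using n by simp
      also have "\<dots> \<le> 2 powr real q" unfolding q_def by (intro powr_mono real_nat_ceiling_ge) simp
      also have "\<dots> = real (2 ^ q)" by (simp add: powr_realpow)
      finally show ?thesis by (simp only: of_nat_le_iff)
    qed
    have qD: "q \<le> D"
    proof -
      have "(2 * q) ^ 1 \<le> (2 * q) ^ r" using q s(2) by (intro power_increasing) auto
      then show ?thesis by (simp add: D_def)
    qed
    have N: "(2 * M) ^ D = 2 ^ (D * (\<kappa> + 3 * D + 2))"
      by (simp add: M_def power_mult[symmetric] mult.commute flip: power_Suc)
    have "1 * \<kappa> \<le> D * (\<kappa> + 3 * D + 2)" "q * 1 \<le> D * (\<kappa> + 3 * D + 2)"
      using q qD by (intro mult_mono; simp)+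
    then have "2 ^ \<kappa> \<le> (2 * M) ^ D" "2 ^ q \<le> (2 * M) ^ D"
      unfolding N by (intro power_increasing; simp)+
    moreover have "M > (3 * (t * t) + 2) * 2 ^ (3 * D + 1)"
    proof -
      have "(3 * (t * t) + 2) * 2 ^ (3 * D + 1) < 2 ^ \<kappa> * 2 ^ (3 * D + 1)"
        using \<kappa>(1) by (intro mult_strict_right_mono) auto
      then show ?thesis by (simp add: M_def power_add mult_ac)
    qed
    ultimately have "semialg_ramsey_property 1 t 3 (Suc r) n (((2 * M) ^ D) ^ 3)"
      using q nq \<kappa>(2) s(1) by (intro semialg_ramsey_propertyI[of t D M q r n]) (auto simp: D_def)
    then have "ereal_of_enat (semialg_ramsey 1 t 3 s n) \<le> ereal (real (((2 * M) ^ D) ^ 3))"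
      unfolding s(1) by (rule semialg_ramsey_le)
    also have "((2 * M) ^ D) ^ 3 = 2 ^ (3 * (D * (\<kappa> + 3 * D + 2)))"
      unfolding N by (simp only: power_mult[symmetric] mult.commute)
    also have "real (2 ^ (3 * (D * (\<kappa> + 3 * D + 2)))) = 2 powr real (3 * (D * (\<kappa> + 3 * D + 2)))"
      by (subst powr_realpow) auto
    also have "ereal \<dots> \<le> ereal (2 powr ((log 2 (real n)) powr c))"
      using polylog_bound[OF n, of r \<kappa>] by (simp add: c_def D_def q_def)
    finally show ?thesis .
  qed
  \<comment> \<open>For \<open>n = 2\<close> the base of the inner power is 1, so no choice of \<open>c\<close> helps.\<close>
  moreover have "ereal_of_enat (semialg_ramsey 1 t 3 s 2) \<le> ereal (2 powr ((log 2 (real 2)) powr c))"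
    using semialg_ramsey_le[OF semialg_ramsey_property_two] by simp
  ultimately have "\<forall>n::nat. n \<ge> 2 \<longrightarrow>
      ereal_of_enat (semialg_ramsey 1 t 3 s n) \<le> ereal (2 powr ((log 2 (real n)) powr c))"
    by (metis Suc_leI le_neq_implies_less numeral_2_eq_2 numeral_3_eq_3)
  then show ?thesis by blast
qed

end
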